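(* Let $\Phi$ be a root system of type $E_7$ and $\omega=\omega_7$. Then the set $\Phi_{\omega,0}^+=\{\beta\in\Phi^+:\beta^\omega=0\}$ is $$\Phi_{\omega,0}^+=\{\alpha_2+\alpha_3+2\alpha_4+2\alpha_5+2\alpha_6+\alpha_7,\ \ \alpha_1+\alpha_2+2\alpha_3+2\alpha_4+\alpha_5+\alpha_6+\alpha_7,\ \ \alpha_1+\alpha_2+\alpha_3+2\alpha_4+2\alpha_5+\alpha_6+\alpha_7\}.$$ In particular, with $\alpha_1=\tfrac12(e_1-e_2-e_3-e_4-e_5-e_6-e_7+e_8)$, $\alpha_2=e_2+e_1$, $\alpha_3=e_2-e_1$, $\alpha_4=e_3-e_2$, $\alpha_5=e_4-e_3$, $\alpha_6=e_5-e_4$, $\alpha_7=e_6-e_5$, one has $$\Phi_{\omega,0}^+=\{e_6+e_5,\ \tfrac12(-e_1+e_2+e_3-e_4-e_5+e_6-e_7+e_8),\ \tfrac12(e_1-e_2-e_3+e_4-e_5+e_6-e_7+e_8)\}.$$ Hence $P(0)=\{\pm1\}$.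
   Context: With $e_1,\dots,e_8$ the standard basis of $\mathbb{R}^8$, $\Phi$ of type $E_7$ has positive roots $\Phi^+=\{e_i\pm e_k:1\le k<i\le6\}\sqcup\{e_8-e_7\}\sqcup\{\tfrac12(\nu_1e_1+\cdots+\nu_6e_6-e_7+e_8):\nu_1,\dots,\nu_6\in\{\pm1\},\ \nu_1\cdots\nu_6=-1\}$, and basis $\Delta=\{\alpha_1,\dots,\alpha_7\}$ given by the formulas in the claim (Bourbaki numbering); $E$ is the span of $\Phi$. Let $\tilde\alpha=\sum_{i=1}^7n_i\alpha_i$ be the highest root, $\alpha_0=-\tilde\alpha$, $n_0=1$; then $J=\{i\in\{0,\dots,7\}:n_i=1\}=\{0,7\}$. Let $w_7$ be the longest element of the subgroup of the Weyl group $W$ generated by $s_{\alpha_1},\dots,s_{\alpha_6}$, $w_0$ the longest element of $W$, and $\omega=\omega_7=w_7w_0$; it acts on $\{\alpha_0,\dots,\alpha_7\}$ by the index permutation $\sigma=(0\ 7)(1\ 6)(3\ 5)$. Put $x^\omega=\frac1{o(\omega)}\sum_{t=1}^{o(\omega)}\omega^t(x)$ with $o(\omega)=2$ the order of $\omega$. Let $\varpi_1^\vee,\dots,\varpi_7^\vee\in E$ be the dual basis of $\Delta$, $\varpi_0^\vee=0$, and $\pi_0^7=\varpi_0^\vee+\varpi_7^\vee$ the sum over the $\langle\sigma\rangle$-orbit of $0$. Put $P(0)=\{(\gamma,\pi_0^7):\gamma\in\Phi,\ \gamma^\omega=0\}$. *)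

theory Defs
  imports "HOL-Analysis.Analysis"
begin

definition reflection :: "'a::euclidean_space \<Rightarrow> 'a \<Rightarrow> 'a" where
  "reflection a x = x - (2 * (x \<bullet> a) / (a \<bullet> a)) *\<^sub>R a"

text \<open>A reduced crystallographic root system in the Euclidean space \<open>span \<Phi>\<close>, which may be a
  proper subspace of the ambient type (as for $E_7$ inside $\mathbb{R}^8$).\<close>

definition root_system :: "'a::euclidean_space set \<Rightarrow> bool" where
  "root_system \<Phi> \<longleftrightarrow> finite \<Phi> \<and> 0 \<notin> \<Phi> \<and>
     (\<forall>a\<in>\<Phi>. \<forall>b\<in>\<Phi>. reflection a b \<in> \<Phi>) \<and>
     (\<forall>a\<in>\<Phi>. \<forall>b\<in>\<Phi>. 2 * (b \<bullet> a) / (a \<bullet> a) \<in> \<int>) \<and>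
     (\<forall>a\<in>\<Phi>. \<forall>c::real. c *\<^sub>R a \<in> \<Phi> \<longrightarrow> c = 1 \<or> c = -1)"

text \<open>A numbered base \<open>\<alpha> 1, \<dots>, \<alpha> 7\<close>; the values of \<open>\<alpha>\<close> at other indices are irrelevant.\<close>

definition root_base7 :: "'a::euclidean_space set \<Rightarrow> (nat \<Rightarrow> 'a) \<Rightarrow> bool" where
  "root_base7 \<Phi> \<alpha> \<longleftrightarrow> \<alpha> ` {1..7} \<subseteq> \<Phi> \<and> inj_on \<alpha> {1..7} \<and> independent (\<alpha> ` {1..7}) \<and>
     (\<forall>\<beta>\<in>\<Phi>. \<exists>c :: nat \<Rightarrow> int. \<beta> = (\<Sum>i=1..7. of_int (c i) *\<^sub>R \<alpha> i) \<and>
        ((\<forall>i\<in>{1..7}. 0 \<le> c i) \<or> (\<forall>i\<in>{1..7}. c i \<le> 0)))"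

text \<open>The Dynkin diagram of type $E_7$ in Bourbaki numbering: the path 1-3-4-5-6-7, with the
  additional node 2 attached to 4.\<close>

definition E7_edges :: "nat set set" where
  "E7_edges = {{1,3}, {3,4}, {2,4}, {4,5}, {5,6}, {6,7}}"

definition E7_cartan :: "nat \<Rightarrow> nat \<Rightarrow> real" where
  "E7_cartan i j = (if i = j then 2 else if {i,j} \<in> E7_edges then -1 else 0)"

definition E7_root_system :: "'a::euclidean_space set \<Rightarrow> (nat \<Rightarrow> 'a) \<Rightarrow> bool" where
  "E7_root_system \<Phi> \<alpha> \<longleftrightarrow> root_system \<Phi> \<and> root_base7 \<Phi> \<alpha> \<and>
     (\<forall>i\<in>{1..7}. \<forall>j\<in>{1..7}. 2 * (\<alpha> i \<bullet> \<alpha> j) / (\<alpha> j \<bullet> \<alpha> j) = E7_cartan i j)"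

definition nonneg_comb :: "(nat \<Rightarrow> 'a::euclidean_space) \<Rightarrow> 'a \<Rightarrow> bool" where
  "nonneg_comb \<alpha> x \<longleftrightarrow>
     (\<exists>c :: nat \<Rightarrow> real. (\<forall>i\<in>{1..7}. 0 \<le> c i) \<and> x = (\<Sum>i=1..7. c i *\<^sub>R \<alpha> i))"

definition positive_roots :: "'a::euclidean_space set \<Rightarrow> (nat \<Rightarrow> 'a) \<Rightarrow> 'a set" where
  "positive_roots \<Phi> \<alpha> = {\<beta> \<in> \<Phi>. nonneg_comb \<alpha> \<beta>}"

definition highest_root :: "'a::euclidean_space set \<Rightarrow> (nat \<Rightarrow> 'a) \<Rightarrow> 'a" where
  "highest_root \<Phi> \<alpha> = (THE \<theta>. \<theta> \<in> \<Phi> \<and> (\<forall>\<beta>\<in>\<Phi>. nonneg_comb \<alpha> (\<theta> - \<beta>)))"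

definition extended_simple :: "'a::euclidean_space set \<Rightarrow> (nat \<Rightarrow> 'a) \<Rightarrow> nat \<Rightarrow> 'a" where
  "extended_simple \<Phi> \<alpha> i = (if i = 0 then - highest_root \<Phi> \<alpha> else \<alpha> i)"

definition reflection_word :: "'a::euclidean_space list \<Rightarrow> 'a \<Rightarrow> 'a" where
  "reflection_word as = foldr (\<lambda>a w. reflection a \<circ> w) as id"

text \<open>Reflections are involutions, so words in them already form the generated group. Its elements
  are maps on the whole ambient space; they fix the orthogonal complement of the roots pointwise.\<close>

definition reflection_group :: "'a::euclidean_space set \<Rightarrow> ('a \<Rightarrow> 'a) set" where
  "reflection_group A = reflection_word ` {as. set as \<subseteq> A}"

definition refl_length :: "'a::euclidean_space set \<Rightarrow> ('a \<Rightarrow> 'a) \<Rightarrow> nat" where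
  "refl_length S w = (LEAST n. \<exists>as. set as \<subseteq> S \<and> length as = n \<and> reflection_word as = w)"

definition longest_element :: "'a::euclidean_space set \<Rightarrow> ('a \<Rightarrow> 'a) set \<Rightarrow> 'a \<Rightarrow> 'a" where
  "longest_element S G = (THE w. w \<in> G \<and> (\<forall>v\<in>G. refl_length S v \<le> refl_length S w))"

definition w_0 :: "'a::euclidean_space set \<Rightarrow> (nat \<Rightarrow> 'a) \<Rightarrow> 'a \<Rightarrow> 'a" where
  "w_0 \<Phi> \<alpha> = longest_element (\<alpha> ` {1..7}) (reflection_group \<Phi>)"

definition w_7 :: "(nat \<Rightarrow> 'a::euclidean_space) \<Rightarrow> 'a \<Rightarrow> 'a" where
  "w_7 \<alpha> = longest_element (\<alpha> ` {1..6}) (reflection_group (\<alpha> ` {1..6}))"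

definition omega7 :: "'a::euclidean_space set \<Rightarrow> (nat \<Rightarrow> 'a) \<Rightarrow> 'a \<Rightarrow> 'a" where
  "omega7 \<Phi> \<alpha> = w_7 \<alpha> \<circ> w_0 \<Phi> \<alpha>"

definition map_order :: "('a \<Rightarrow> 'a) \<Rightarrow> nat" where
  "map_order w = (LEAST t. 0 < t \<and> w ^^ t = id)"

definition average :: "('a::euclidean_space \<Rightarrow> 'a) \<Rightarrow> 'a \<Rightarrow> 'a" where
  "average w x = (1 / real (map_order w)) *\<^sub>R (\<Sum>t=1..map_order w. (w ^^ t) x)"

definition Phi_omega0_pos :: "'a::euclidean_space set \<Rightarrow> (nat \<Rightarrow> 'a) \<Rightarrow> 'a set" where
  "Phi_omega0_pos \<Phi> \<alpha> = {\<beta> \<in> positive_roots \<Phi> \<alpha>. average (omega7 \<Phi> \<alpha>) \<beta> = 0}"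

definition coweight :: "'a::euclidean_space set \<Rightarrow> (nat \<Rightarrow> 'a) \<Rightarrow> nat \<Rightarrow> 'a" where
  "coweight \<Phi> \<alpha> i = (if i = 0 then 0 else
     (THE v. v \<in> span \<Phi> \<and> (\<forall>j\<in>{1..7}. v \<bullet> \<alpha> j = (if j = i then 1 else 0))))"

text \<open>The orbit of an index under the permutation that \<open>\<omega>\<close> induces on
  \<open>\<alpha> 0 = - highest_root, \<alpha> 1, \<dots>, \<alpha> 7\<close>, that is, under (0 7)(1 6)(3 5).\<close>

definition index_orbit :: "'a::euclidean_space set \<Rightarrow> (nat \<Rightarrow> 'a) \<Rightarrow> nat \<Rightarrow> nat set" where
  "index_orbit \<Phi> \<alpha> j = {i \<in> {0..7}. \<exists>t. (omega7 \<Phi> \<alpha> ^^ t) (extended_simple \<Phi> \<alpha> j) =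
     extended_simple \<Phi> \<alpha> i}"

definition orbit_coweight :: "'a::euclidean_space set \<Rightarrow> (nat \<Rightarrow> 'a) \<Rightarrow> nat \<Rightarrow> 'a" where
  "orbit_coweight \<Phi> \<alpha> j = (\<Sum>i\<in>index_orbit \<Phi> \<alpha> j. coweight \<Phi> \<alpha> i)"

definition P0 :: "'a::euclidean_space set \<Rightarrow> (nat \<Rightarrow> 'a) \<Rightarrow> real set" where
  "P0 \<Phi> \<alpha> = {\<gamma> \<bullet> orbit_coweight \<Phi> \<alpha> 0 | \<gamma>. \<gamma> \<in> \<Phi> \<and> average (omega7 \<Phi> \<alpha>) \<gamma> = 0}"

text \<open>In the index type \<open>8\<close> one has \<open>8 = 0\<close>, so that \<open>e 1, \<dots>, e 8\<close> are the eight distinct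
  standard basis vectors.\<close>

definition e :: "nat \<Rightarrow> real ^ 8" where
  "e i = axis (of_nat i) 1"

definition E7_pos :: "(real ^ 8) set" where
  "E7_pos = {e i + e k | i k. 1 \<le> k \<and> k < i \<and> i \<le> 6} \<union> {e i - e k | i k. 1 \<le> k \<and> k < i \<and> i \<le> 6}
     \<union> {e 8 - e 7}
     \<union> {(1/2) *\<^sub>R ((\<Sum>i=1..6. \<nu> i *\<^sub>R e i) - e 7 + e 8) | \<nu> :: nat \<Rightarrow> real.
          (\<forall>i\<in>{1..6}. \<nu> i \<in> {1, -1}) \<and> (\<Prod>i=1..6. \<nu> i) = -1}"

definition E7_roots :: "(real ^ 8) set" where
  "E7_roots = E7_pos \<union> uminus ` E7_pos"

definition E7_simple :: "nat \<Rightarrow> real ^ 8" where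
  "E7_simple i =
     (if i = 1 then (1/2) *\<^sub>R (e 1 - e 2 - e 3 - e 4 - e 5 - e 6 - e 7 + e 8)
      else if i = 2 then e 2 + e 1
      else e (i - 1) - e (i - 2))"

text \<open>The following facts lead to \<open>E7_root_system E7_roots E7_simple\<close> and
  \<open>positive_roots E7_roots E7_simple = E7_pos\<close>: the explicit set is a root system of type $E_7$ with
  base \<open>E7_simple\<close>, and positivity with respect to this base selects exactly \<open>E7_pos\<close>.\<close>

lemma exhaust_8:
  fixes x :: 8
  shows "x = 1 \<or> x = 2 \<or> x = 3 \<or> x = 4 \<or> x = 5 \<or> x = 6 \<or> x = 7 \<or> x = 8"
proof (induct x)
  case (of_int z)
  then have "0 \<le> z" and "z < 8" by simp_all
  then have "z = 0 \<or> z = 1 \<or> z = 2 \<or> z = 3 \<or> z = 4 \<or> z = 5 \<or> z = 6 \<or> z = 7" by arith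
  then show ?case by auto
qed

lemma UNIV_8: "(UNIV :: 8 set) = {1, 2, 3, 4, 5, 6, 7, 8}"
  using exhaust_8 by auto

lemma forall_8: "(\<forall>i::8. P i) \<longleftrightarrow> P 1 \<and> P 2 \<and> P 3 \<and> P 4 \<and> P 5 \<and> P 6 \<and> P 7 \<and> P 8"
  by (metis exhaust_8)

lemma sum_8: "sum f (UNIV :: 8 set) = f 1 + f 2 + f 3 + f 4 + f 5 + f 6 + f 7 + f 8"
  unfolding UNIV_8 by (simp add: add_ac)

lemma inner_8: "(x :: real ^ 8) \<bullet> y = x$1 * y$1 + x$2 * y$2 + x$3 * y$3 + x$4 * y$4 +
    x$5 * y$5 + x$6 * y$6 + x$7 * y$7 + x$8 * y$8"
  by (simp add: inner_vec_def sum_8)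

lemma e_nth: "e i $ j = (if j = of_nat i then 1 else 0)"
  by (auto simp: e_def axis_def)

lemma sum_1_7: "sum f {1..7::nat} = f 1 + f 2 + f 3 + f 4 + f 5 + f 6 + f 7"
  by (simp add: eval_nat_numeral add_ac)

lemma sum_1_6: "sum f {1..6::nat} = f 1 + f 2 + f 3 + f 4 + f 5 + f 6"
  by (simp add: eval_nat_numeral add_ac)

lemma prod_1_6: "prod f {1..6::nat} = f 1 * f 2 * f 3 * f 4 * f 5 * f 6"
  by (simp add: eval_nat_numeral mult_ac)

lemma ball_1_7: "(\<forall>i\<in>{1..7::nat}. P i) \<longleftrightarrow> P 1 \<and> P 2 \<and> P 3 \<and> P 4 \<and> P 5 \<and> P 6 \<and> P 7"
proof -
  have "{1..7::nat} = {1,2,3,4,5,6,7}" by auto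
  then show ?thesis by simp
qed

lemma ball_1_6: "(\<forall>i\<in>{1..6::nat}. P i) \<longleftrightarrow> P 1 \<and> P 2 \<and> P 3 \<and> P 4 \<and> P 5 \<and> P 6"
proof -
  have "{1..6::nat} = {1,2,3,4,5,6}" by auto
  then show ?thesis by simp
qed

lemma simple_comb_nth:
  "(\<Sum>i=1..7. c i *\<^sub>R E7_simple i) = x \<longleftrightarrow>
     x$1 = c 1/2 + c 2 - c 3 \<and> x$2 = - c 1/2 + c 2 + c 3 - c 4 \<and> x$3 = - c 1/2 + c 4 - c 5 \<and>
     x$4 = - c 1/2 + c 5 - c 6 \<and> x$5 = - c 1/2 + c 6 - c 7 \<and> x$6 = - c 1/2 + c 7 \<and>
     x$7 = - c 1/2 \<and> x$8 = c 1/2"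
  unfolding sum_1_7 vec_eq_iff forall_8
  by (simp add: E7_simple_def e_nth algebra_simps) (auto simp: algebra_simps)

lemma cartan_simple:
  "\<forall>i\<in>{1..7}. \<forall>j\<in>{1..7}. E7_simple i \<bullet> E7_simple j = E7_cartan i j"
  unfolding ball_1_7
  by (simp add: E7_simple_def e_nth inner_8 E7_cartan_def E7_edges_def doubleton_eq_iff)

text \<open>The coefficients, with respect to \<open>E7_simple\<close>, of a vector \<open>x\<close> with \<open>x$7 = - x$8\<close>.\<close>

definition E7_coef :: "real ^ 8 \<Rightarrow> nat \<Rightarrow> real" where
  "E7_coef x i = (if i = 1 then 2 * x$8
     else if i = 2 then (x$1 + x$2 + x$3 + x$4 + x$5 + x$6 + 4 * x$8) / 2
     else if i = 3 then (- x$1 + x$2 + x$3 + x$4 + x$5 + x$6 + 6 * x$8) / 2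
     else if i = 4 then x$3 + x$4 + x$5 + x$6 + 4 * x$8
     else if i = 5 then x$4 + x$5 + x$6 + 3 * x$8
     else if i = 6 then x$5 + x$6 + 2 * x$8
     else x$6 + x$8)"

lemma coef_comb: "x$7 = - x$8 \<Longrightarrow> (\<Sum>i=1..7. E7_coef x i *\<^sub>R E7_simple i) = x"
  unfolding simple_comb_nth by (simp add: E7_coef_def field_simps)

lemma coef_nat:
  assumes "x \<in> E7_pos"
  shows "x \<bullet> x = 2 \<and> x$7 = - x$8 \<and> (\<forall>i\<in>{1..7}. E7_coef x i \<in> \<nat>)"
proof -
  have N: "(1::real) \<in> \<nat>" "(0::real) \<in> \<nat>" "(2::real) \<in> \<nat>" "(3::real) \<in> \<nat>" "(4::real) \<in> \<nat>" by simp_all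
  consider (a) i k where "1 \<le> k" "k < i" "i \<le> 6" "x = e i + e k \<or> x = e i - e k"
    | (b) "x = e 8 - e 7"
    | (c) \<nu> where "\<forall>i\<in>{1..6}. \<nu> i \<in> {1, -1::real}" "(\<Prod>i=1..6. \<nu> i) = -1"
        "x = (1/2) *\<^sub>R ((\<Sum>i=1..6. \<nu> i *\<^sub>R e i) - e 7 + e 8)"
    using assms unfolding E7_pos_def by blast
  then show ?thesis
  proof cases
    case a
    then have "i = 2 \<or> i = 3 \<or> i = 4 \<or> i = 5 \<or> i = 6" "k = 1 \<or> k = 2 \<or> k = 3 \<or> k = 4 \<or> k = 5" by auto
    with a show ?thesis
      unfolding ball_1_7
      by (elim disjE) (simp_all add: inner_8 e_nth E7_coef_def)
  next
    case b
    then show ?thesis unfolding ball_1_7 by (simp add: inner_8 e_nth E7_coef_def)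
  next
    case c
    have v: "\<nu> 1 = 1 \<or> \<nu> 1 = -1" "\<nu> 2 = 1 \<or> \<nu> 2 = -1" "\<nu> 3 = 1 \<or> \<nu> 3 = -1"
      "\<nu> 4 = 1 \<or> \<nu> 4 = -1" "\<nu> 5 = 1 \<or> \<nu> 5 = -1" "\<nu> 6 = 1 \<or> \<nu> 6 = -1"
      using c(1) unfolding ball_1_6 by auto
    have x: "x$1 = \<nu> 1/2" "x$2 = \<nu> 2/2" "x$3 = \<nu> 3/2" "x$4 = \<nu> 4/2" "x$5 = \<nu> 5/2" "x$6 = \<nu> 6/2"
       "x$7 = -1/2" "x$8 = 1/2"
      unfolding c(3) sum_1_6 by (simp_all add: e_nth)
    show ?thesis using v c(2)
      unfolding ball_1_7 prod_1_6 inner_8 E7_coef_def x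
      by (elim disjE) simp_all
  qed
qed

lemma roots_minus: "x \<in> E7_roots \<Longrightarrow> - x \<in> E7_roots"
  unfolding E7_roots_def by auto

lemma pm_mem:
  assumes "i \<noteq> k" "i \<in> {1..6}" "k \<in> {1..6}" "s = 1 \<or> s = -1" "t = 1 \<or> t = -1"
  shows "s *\<^sub>R e i + t *\<^sub>R e k \<in> E7_roots"
proof -
  have *: "s *\<^sub>R e i + t *\<^sub>R e k \<in> E7_roots"
    if "k < i" "i \<in> {1..6}" "k \<in> {1..6}" "s = 1 \<or> s = -1" "t = 1 \<or> t = -1" for i k s t
  proof -
    have p: "e i + e k \<in> E7_pos" "e i - e k \<in> E7_pos" using that unfolding E7_pos_def by auto
    have "- (e i + e k) \<in> E7_roots" "- (e i - e k) \<in> E7_roots"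
      using p unfolding E7_roots_def by blast+
    then show ?thesis using that(4,5) p unfolding E7_roots_def
      by (auto simp: algebra_simps)
  qed
  show ?thesis
  proof (cases "k < i")
    case True then show ?thesis using * assms by blast
  next
    case False
    then have "i < k" using assms by auto
    then show ?thesis using *[of i k t s] assms by (simp add: add.commute)
  qed
qed

lemma int_sq_2:
  fixes z :: "nat \<Rightarrow> int"
  assumes "(\<Sum>i\<in>{1..6}. (z i)^2) = 2"
  shows "(\<Sum>i=1..6. of_int (z i) *\<^sub>R e i) \<in> E7_roots"
proof -
  define N where "N = {i\<in>{1..6}. z i \<noteq> 0}"
  have fin: "finite N" unfolding N_def by auto
  have le: "(z i)^2 \<le> 2" if "i \<in> {1..6}" for i
    using member_le_sum[of i "{1..6}" "\<lambda>i. (z i)^2"] that assms by auto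
  have one: "z i = 1 \<or> z i = -1" if "i \<in> N" for i
  proof -
    have "\<bar>z i\<bar> < 2"
    proof (rule ccontr)
      assume "\<not> \<bar>z i\<bar> < 2"
      then have "2^2 \<le> \<bar>z i\<bar>^2" by (intro power_mono) auto
      then show False using le[of i] that by (auto simp: N_def)
    qed
    then show ?thesis using that by (auto simp: N_def)
  qed
  have "(\<Sum>i\<in>{1..6}. (z i)^2) = (\<Sum>i\<in>N. (z i)^2)"
    by (rule sum.mono_neutral_right) (auto simp: N_def)
  also have "\<dots> = (\<Sum>i\<in>N. 1)" by (rule sum.cong) (auto dest!: one)
  finally have "card N = 2" using assms by simp
  then obtain i k where N: "N = {i, k}" "i \<noteq> k" by (auto simp: card_2_iff)
  have "(\<Sum>i=1..6. of_int (z i) *\<^sub>R e i) = (\<Sum>i\<in>N. of_int (z i) *\<^sub>R e i)"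
    by (rule sum.mono_neutral_right) (auto simp: N_def)
  also have "\<dots> = of_int (z i) *\<^sub>R e i + of_int (z k) *\<^sub>R e k" using N by simp
  also have "\<dots> \<in> E7_roots"
  proof (rule pm_mem[OF N(2)])
    have "i \<in> N" "k \<in> N" using N by auto
    then show "i \<in> {1..6}" "k \<in> {1..6}" unfolding N_def by auto
    show "of_int (z i) = 1 \<or> (of_int (z i) :: real) = - 1" using one[OF \<open>i \<in> N\<close>] by auto
    show "of_int (z k) = 1 \<or> (of_int (z k) :: real) = - 1" using one[OF \<open>k \<in> N\<close>] by auto
  qed
  finally show ?thesis .
qed

lemma comb_norm_2:
  fixes c :: "nat \<Rightarrow> int"
  assumes x: "x = (\<Sum>i=1..7. of_int (c i) *\<^sub>R E7_simple i)" and n: "x \<bullet> x = 2" and c: "0 \<le> c 1"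
  shows "x \<in> E7_roots"
proof -
  define y where "y = (\<lambda>i::nat. if i = 1 then c 1 + 2 * c 2 - 2 * c 3
    else if i = 2 then - c 1 + 2 * c 2 + 2 * c 3 - 2 * c 4
    else if i = 3 then - c 1 + 2 * c 4 - 2 * c 5
    else if i = 4 then - c 1 + 2 * c 5 - 2 * c 6
    else if i = 5 then - c 1 + 2 * c 6 - 2 * c 7
    else - c 1 + 2 * c 7)"
  have co: "x$1 = y 1/2 \<and> x$2 = y 2/2 \<and> x$3 = y 3/2 \<and> x$4 = y 4/2 \<and> x$5 = y 5/2 \<and> x$6 = y 6/2 \<and>
     x$7 = - c 1 / 2 \<and> x$8 = c 1 / 2"
    using x[symmetric] unfolding simple_comb_nth y_def by (simp add: field_simps)
  have xe: "x = (1/2) *\<^sub>R ((\<Sum>i=1..6. of_int (y i) *\<^sub>R e i) - of_int (c 1) *\<^sub>R e 7 + of_int (c 1) *\<^sub>R e 8)"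
    unfolding vec_eq_iff forall_8 sum_1_6 using co by (simp add: e_nth)
  have "(of_int ((y 1)^2 + (y 2)^2 + (y 3)^2 + (y 4)^2 + (y 5)^2 + (y 6)^2 + 2 * (c 1)^2) :: real) = of_int 8"
    using n unfolding inner_8 using co by (simp add: power2_eq_square field_simps)
  then have s: "(y 1)^2 + (y 2)^2 + (y 3)^2 + (y 4)^2 + (y 5)^2 + (y 6)^2 + 2 * (c 1)^2 = 8"
    by (simp only: of_int_eq_iff)
  have nn: "0 \<le> (y i)^2" for i by simp
  have "c 1 \<le> 2"
  proof (rule ccontr)
    assume "\<not> c 1 \<le> 2"
    then have "3^2 \<le> (c 1)^2" by (intro power_mono) auto
    moreover have "(3::int)^2 = 9" by simp
    ultimately show False using s nn[of 1] nn[of 2] nn[of 3] nn[of 4] nn[of 5] nn[of 6] by linarith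
  qed
  then consider (0) "c 1 = 0" | (1) "c 1 = 1" | (2) "c 1 = 2" using c by linarith
  then show ?thesis
  proof cases
    case 0
    define z where "z = (\<lambda>i. y i div 2)"
    have ev: "y i = 2 * z i" for i unfolding z_def y_def using 0 by auto
    have "(\<Sum>i\<in>{1..6}. (z i)^2) = 2"
      unfolding sum_1_6 using s unfolding ev 0 by (simp add: power_mult_distrib)
    from int_sq_2[OF this] show ?thesis
      unfolding xe ev 0 by (simp add: scaleR_sum_right)
  next
    case 1
    have odd: "1 \<le> (y i)^2" for i
    proof -
      have "odd (y i)" unfolding y_def using 1 by auto
      then have "y i \<noteq> 0" by auto
      then show ?thesis by (simp add: int_one_le_iff_zero_less)
    qed
    have q: "(y 1)^2 = 1" "(y 2)^2 = 1" "(y 3)^2 = 1" "(y 4)^2 = 1" "(y 5)^2 = 1" "(y 6)^2 = 1"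
      using s 1 odd[of 1] odd[of 2] odd[of 3] odd[of 4] odd[of 5] odd[of 6] by simp_all
    have "y 1 + y 2 + y 3 + y 4 + y 5 + y 6 = 4 * (c 2 - 1)"
      unfolding y_def using 1 by simp
    then have m: "(y 1 + y 2 + y 3 + y 4 + y 5 + y 6) mod 4 = 0" by simp
    have q': "y 1 = 1 \<or> y 1 = -1" "y 2 = 1 \<or> y 2 = -1" "y 3 = 1 \<or> y 3 = -1"
       "y 4 = 1 \<or> y 4 = -1" "y 5 = 1 \<or> y 5 = -1" "y 6 = 1 \<or> y 6 = -1"
      using q unfolding power2_eq_1_iff by blast+
    have p: "y 1 * y 2 * y 3 * y 4 * y 5 * y 6 = -1"
      using q' m by (elim disjE) simp_all
    then have "(of_int (y 1 * y 2 * y 3 * y 4 * y 5 * y 6)::real) = of_int (-1)" by (simp only:)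
    then have p': "(\<Prod>i=1..6. of_int (y i) :: real) = -1" unfolding prod_1_6 by simp
    have "\<forall>i\<in>{1..6}. of_int (y i) \<in> {1, -1 :: real}"
      unfolding ball_1_6 using q' by auto
    then have "x \<in> E7_pos" unfolding E7_pos_def using p' xe[unfolded 1]
      by (intro UnI2 CollectI exI[of _ "\<lambda>i. of_int (y i)"]) simp
    then show ?thesis unfolding E7_roots_def by simp
  next
    case 2
    have "(y 1)^2 + (y 2)^2 + (y 3)^2 + (y 4)^2 + (y 5)^2 + (y 6)^2 = 0" using s 2 by simp
    then have le: "(y 1)^2 \<le> 0" "(y 2)^2 \<le> 0" "(y 3)^2 \<le> 0" "(y 4)^2 \<le> 0" "(y 5)^2 \<le> 0" "(y 6)^2 \<le> 0"
      using nn[of 1] nn[of 2] nn[of 3] nn[of 4] nn[of 5] nn[of 6] by linarith+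
    then have "y 1 = 0" "y 2 = 0" "y 3 = 0" "y 4 = 0" "y 5 = 0" "y 6 = 0" by simp_all
    then have "x = e 8 - e 7" unfolding vec_eq_iff forall_8 using co 2 by (simp add: e_nth)
    then show ?thesis unfolding E7_roots_def E7_pos_def by simp
  qed
qed

lemma coef_eq:
  assumes "x = (\<Sum>i=1..7. c i *\<^sub>R E7_simple i)"
  shows "\<forall>i\<in>{1..7}. c i = E7_coef x i"
  using assms[symmetric] unfolding simple_comb_nth ball_1_7 E7_coef_def by (simp add: field_simps)

lemma E7_roots_eq:
  "E7_roots = {x. (\<exists>c :: nat \<Rightarrow> int. x = (\<Sum>i=1..7. of_int (c i) *\<^sub>R E7_simple i)) \<and> x \<bullet> x = 2}"
  (is "_ = ?R")
proof
  have neg: "- x \<in> ?R" if "x \<in> ?R" for x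
  proof -
    obtain c :: "nat \<Rightarrow> int" where "x = (\<Sum>i=1..7. of_int (c i) *\<^sub>R E7_simple i)" using \<open>x \<in> ?R\<close> by auto
    then have "- x = (\<Sum>i=1..7. of_int (- c i) *\<^sub>R E7_simple i)" by (simp add: sum_negf)
    moreover have "- x \<bullet> - x = 2" using that by simp
    ultimately show ?thesis by (intro CollectI conjI exI[of _ "\<lambda>i. - c i"])
  qed
  have pos: "x \<in> ?R" if "x \<in> E7_pos" for x
  proof -
    have *: "x \<bullet> x = 2" "x$7 = - x$8" "\<forall>i\<in>{1..7}. E7_coef x i \<in> \<nat>" using coef_nat[OF that] by auto
    have "x = (\<Sum>i=1..7. E7_coef x i *\<^sub>R E7_simple i)" using coef_comb[OF *(2)] by simp
    also have "\<dots> = (\<Sum>i=1..7. of_int \<lfloor>E7_coef x i\<rfloor> *\<^sub>R E7_simple i)"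
    proof (rule sum.cong)
      fix i :: nat assume "i \<in> {1..7}"
      then have "E7_coef x i \<in> \<nat>" using *(3) by blast
      then show "E7_coef x i *\<^sub>R E7_simple i = of_int \<lfloor>E7_coef x i\<rfloor> *\<^sub>R E7_simple i"
        by (elim Nats_cases) simp
    qed simp
    finally show ?thesis using *(1) by (auto intro!: exI[of _ "\<lambda>i. \<lfloor>E7_coef x i\<rfloor>"])
  qed
  show "E7_roots \<subseteq> ?R" unfolding E7_roots_def using pos neg by blast
next
  show "?R \<subseteq> E7_roots"
  proof
    fix x assume "x \<in> ?R"
    then obtain c :: "nat \<Rightarrow> int" where c: "x = (\<Sum>i=1..7. of_int (c i) *\<^sub>R E7_simple i)" and n: "x \<bullet> x = 2" by auto
    show "x \<in> E7_roots"
    proof (cases "0 \<le> c 1")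
      case True then show ?thesis using comb_norm_2 c n by blast
    next
      case False
      have "- x = (\<Sum>i=1..7. of_int (- c i) *\<^sub>R E7_simple i)" using c by (simp add: sum_negf)
      then have "- x \<in> E7_roots" by (rule comb_norm_2) (use n False in auto)
      then show ?thesis using roots_minus by fastforce
    qed
  qed
qed

lemma inner_int:
  assumes "x \<in> E7_roots" "y \<in> E7_roots"
  shows "x \<bullet> y \<in> \<int>"
proof -
  obtain c d :: "nat \<Rightarrow> int" where c: "x = (\<Sum>i=1..7. of_int (c i) *\<^sub>R E7_simple i)"
    and d: "y = (\<Sum>i=1..7. of_int (d i) *\<^sub>R E7_simple i)"
    using assms unfolding E7_roots_eq by blast
  have "x \<bullet> y = (\<Sum>i=1..7. \<Sum>j=1..7. of_int (c i) * (of_int (d j) * (E7_simple i \<bullet> E7_simple j)))"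
    unfolding c d by (simp only: inner_sum_left inner_sum_right sum_distrib_left inner_scaleR_left inner_scaleR_right)
      (subst sum.swap, simp add: mult_ac)
  also have "\<dots> \<in> \<int>"
    using cartan_simple by (intro Ints_sum Ints_mult) (auto simp: E7_cartan_def)
  finally show ?thesis .
qed

lemma root_norm: "x \<in> E7_roots \<Longrightarrow> x \<bullet> x = 2"
  unfolding E7_roots_eq by blast

lemma finite_E7_roots: "finite E7_roots"
proof -
  define S where "S = (\<lambda>n::int. of_int n / 2 :: real) ` {-4..4}"
  have "x$k \<in> S" if x: "x \<in> E7_roots" for x k
  proof -
    from x obtain c :: "nat \<Rightarrow> int" where c: "x = (\<Sum>i=1..7. of_int (c i) *\<^sub>R E7_simple i)"
      unfolding E7_roots_eq by blast
    have co: "2 * x$1 = of_int (c 1 + 2 * c 2 - 2 * c 3)"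
      "2 * x$2 = of_int (- c 1 + 2 * c 2 + 2 * c 3 - 2 * c 4)"
      "2 * x$3 = of_int (- c 1 + 2 * c 4 - 2 * c 5)" "2 * x$4 = of_int (- c 1 + 2 * c 5 - 2 * c 6)"
      "2 * x$5 = of_int (- c 1 + 2 * c 6 - 2 * c 7)" "2 * x$6 = of_int (- c 1 + 2 * c 7)"
      "2 * x$7 = of_int (- c 1)" "2 * x$8 = of_int (c 1)"
      using c[symmetric] unfolding simple_comb_nth by simp_all
    have "\<forall>k. 2 * x$k \<in> \<int>"
      unfolding forall_8 co by (intro conjI Ints_of_int)
    then obtain n where n: "2 * x$k = of_int n" by (metis Ints_cases)
    have "(norm x)^2 = 2" using root_norm[OF x] by (simp add: power2_norm_eq_inner)
    then have "(norm x)^2 \<le> 2^2" by simp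
    then have "norm x \<le> 2" by (rule power2_le_imp_le) simp
    then have "\<bar>x$k\<bar> \<le> 2" using component_le_norm_cart[of x k] by linarith
    then have "\<bar>real_of_int n\<bar> \<le> 4" using n by linarith
    then have "n \<in> {-4..4}" by auto
    moreover have "x$k = of_int n / 2" using n by simp
    ultimately show "x$k \<in> S" unfolding S_def by blast
  qed
  then have "vec_nth ` E7_roots \<subseteq> PiE UNIV (\<lambda>_. S)" by auto
  moreover have "finite (PiE (UNIV :: 8 set) (\<lambda>_. S))" by (intro finite_PiE) (auto simp: S_def)
  ultimately have "finite (vec_nth ` E7_roots)" by (rule finite_subset)
  then show ?thesis by (rule finite_imageD) (auto simp: inj_on_def vec_nth_inject)
qed

lemma root_system_E7_roots: "root_system E7_roots"
proof -
  have "reflection a b \<in> E7_roots" if a: "a \<in> E7_roots" and b: "b \<in> E7_roots" for a b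
  proof -
    obtain m where m: "b \<bullet> a = of_int m" using inner_int[OF b a] by (metis Ints_cases)
    have r: "reflection a b = b - of_int m *\<^sub>R a" unfolding reflection_def m root_norm[OF a] by simp
    obtain c d :: "nat \<Rightarrow> int" where c: "a = (\<Sum>i=1..7. of_int (c i) *\<^sub>R E7_simple i)"
      and d: "b = (\<Sum>i=1..7. of_int (d i) *\<^sub>R E7_simple i)"
      using a b unfolding E7_roots_eq by blast
    have "reflection a b = (\<Sum>i=1..7. of_int (d i - m * c i) *\<^sub>R E7_simple i)"
      unfolding r by (subst c, subst d) (simp add: sum_subtractf scaleR_sum_right algebra_simps)
    moreover have "reflection a b \<bullet> reflection a b = 2"
      unfolding r using m root_norm[OF a] root_norm[OF b]
      by (simp add: inner_diff_left inner_diff_right inner_commute)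
    ultimately show ?thesis unfolding E7_roots_eq by (intro CollectI conjI exI[of _ "\<lambda>i. d i - m * c i"])
  qed
  moreover have "2 * (b \<bullet> a) / (a \<bullet> a) \<in> \<int>" if "a \<in> E7_roots" "b \<in> E7_roots" for a b
    using inner_int[OF that(2,1)] root_norm[OF that(1)] by simp
  moreover have "r = 1 \<or> r = -1" if "a \<in> E7_roots" "r *\<^sub>R a \<in> E7_roots" for a r
  proof -
    have "r^2 = 1" using root_norm[OF that(1)] root_norm[OF that(2)] by (simp add: power2_eq_square)
    then show ?thesis by (simp add: power2_eq_1_iff)
  qed
  moreover have "0 \<notin> E7_roots" using root_norm by fastforce
  ultimately show ?thesis unfolding root_system_def using finite_E7_roots by blast
qed

lemma root_base7_E7_roots: "root_base7 E7_roots E7_simple"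
proof -
  have norm: "E7_simple i \<bullet> E7_simple i = 2" if "i \<in> {1..7}" for i
    using cartan_simple that by (simp add: E7_cartan_def)
  have mem: "E7_simple i \<in> E7_roots" if "i \<in> {1..7}" for i
  proof -
    have "(\<Sum>j=1..7. of_int (if j = i then 1 else 0) *\<^sub>R E7_simple j) =
       (\<Sum>j=1..7. if j = i then E7_simple j else 0)" by (rule sum.cong) auto
    also have "\<dots> = E7_simple i" using that by simp
    finally have "E7_simple i = (\<Sum>j=1..7. of_int (if j = i then 1 else 0) *\<^sub>R E7_simple j)" by simp
    then show ?thesis unfolding E7_roots_eq
      by (intro CollectI conjI exI[of _ "\<lambda>j. if j = i then 1 else 0"]) (use norm[OF that] in blast)+
  qed
  have inj: "inj_on E7_simple {1..7}"
  proof (rule inj_onI, rule ccontr)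
    fix i j :: nat assume ij: "i \<in> {1..7}" "j \<in> {1..7}" "E7_simple i = E7_simple j" "i \<noteq> j"
    then have "E7_simple i \<bullet> E7_simple j = E7_cartan i j" using cartan_simple by blast
    then show False using norm ij by (auto simp: E7_cartan_def split: if_splits)
  qed
  have ind: "independent (E7_simple ` {1..7})"
  proof (rule independent_if_scalars_zero)
    fix f x assume f: "(\<Sum>x\<in>E7_simple ` {1..7}. f x *\<^sub>R x) = 0" and x: "x \<in> E7_simple ` {1..7}"
    have "0 = (\<Sum>i=1..7. f (E7_simple i) *\<^sub>R E7_simple i)" using f unfolding sum.reindex[OF inj] o_def by (rule sym)
    from coef_eq[OF this] have "\<forall>i\<in>{1..7}. f (E7_simple i) = 0" by (simp add: E7_coef_def)
    then show "f x = 0" using x by auto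
  qed simp
  have sgn: "\<exists>c :: nat \<Rightarrow> int. x = (\<Sum>i=1..7. of_int (c i) *\<^sub>R E7_simple i) \<and> (\<forall>i\<in>{1..7}. 0 \<le> c i)"
    if "x \<in> E7_pos" for x
  proof -
    have xR: "x \<in> E7_roots" using that unfolding E7_roots_def by blast
    obtain c :: "nat \<Rightarrow> int" where c: "x = (\<Sum>i=1..7. of_int (c i) *\<^sub>R E7_simple i)"
      using xR unfolding E7_roots_eq by blast
    have "0 \<le> c i" if i: "i \<in> {1..7}" for i
    proof -
      have "of_int (c i) = E7_coef x i" using coef_eq[OF c] i by blast
      moreover have "E7_coef x i \<in> \<nat>" using coef_nat[OF \<open>x \<in> E7_pos\<close>] i by blast
      ultimately show ?thesis by (metis Nats_cases of_nat_0_le_iff of_int_0_le_iff)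
    qed
    then show ?thesis using c by blast
  qed
  have "\<exists>c :: nat \<Rightarrow> int. x = (\<Sum>i=1..7. of_int (c i) *\<^sub>R E7_simple i) \<and>
     ((\<forall>i\<in>{1..7}. 0 \<le> c i) \<or> (\<forall>i\<in>{1..7}. c i \<le> 0))" if "x \<in> E7_roots" for x
  proof (cases "x \<in> E7_pos")
    case True then show ?thesis using sgn by blast
  next
    case False
    then have "- x \<in> E7_pos" using that unfolding E7_roots_def by auto
    from sgn[OF this] obtain c :: "nat \<Rightarrow> int" where "- x = (\<Sum>i=1..7. of_int (c i) *\<^sub>R E7_simple i)"
      "\<forall>i\<in>{1..7}. 0 \<le> c i" by blast
    then have "- (- x) = (\<Sum>i=1..7. of_int (- c i) *\<^sub>R E7_simple i)" "\<forall>i\<in>{1..7}. - c i \<le> 0"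
      by (simp_all add: sum_negf)
    then show ?thesis by (intro exI[of _ "\<lambda>i. - c i"]) simp
  qed
  then show ?thesis unfolding root_base7_def using mem inj ind by blast
qed

lemma E7_root_system_E7_roots: "E7_root_system E7_roots E7_simple"
proof -
  have "2 * (E7_simple i \<bullet> E7_simple j) / (E7_simple j \<bullet> E7_simple j) = E7_cartan i j"
    if "i \<in> {1..7}" "j \<in> {1..7}" for i j
    using cartan_simple that by (simp add: E7_cartan_def)
  then show ?thesis
    unfolding E7_root_system_def using root_system_E7_roots root_base7_E7_roots by blast
qed

lemma positive_roots_E7_roots: "positive_roots E7_roots E7_simple = E7_pos"
proof
  have pos: "nonneg_comb E7_simple x" if "x \<in> E7_pos" for x
  proof -
    have *: "x$7 = - x$8" "\<forall>i\<in>{1..7}. E7_coef x i \<in> \<nat>" using coef_nat[OF that] by auto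
    have "\<forall>i\<in>{1..7}. 0 \<le> E7_coef x i" using *(2) by (metis Nats_cases of_nat_0_le_iff)
    then show ?thesis unfolding nonneg_comb_def using coef_comb[OF *(1)] by metis
  qed
  show "E7_pos \<subseteq> positive_roots E7_roots E7_simple"
    unfolding positive_roots_def E7_roots_def using pos by blast
  show "positive_roots E7_roots E7_simple \<subseteq> E7_pos"
  proof
    fix x assume x: "x \<in> positive_roots E7_roots E7_simple"
    show "x \<in> E7_pos"
    proof (rule ccontr)
      assume "x \<notin> E7_pos"
      then have "- x \<in> E7_pos" using x unfolding positive_roots_def E7_roots_def by auto
      then obtain d where d: "\<forall>i\<in>{1..7}. 0 \<le> d i" "- x = (\<Sum>i=1..7. d i *\<^sub>R E7_simple i)"
        using pos unfolding nonneg_comb_def by blast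
      obtain c where c: "\<forall>i\<in>{1..7}. 0 \<le> c i" "x = (\<Sum>i=1..7. c i *\<^sub>R E7_simple i)"
        using x unfolding positive_roots_def nonneg_comb_def by blast
      have "0 = (\<Sum>i=1..7. (c i + d i) *\<^sub>R E7_simple i)"
        by (simp only: scaleR_add_left sum.distrib c(2)[symmetric] d(2)[symmetric] add.right_inverse)
      from coef_eq[OF this] have "\<forall>i\<in>{1..7}. c i + d i = 0" by (simp add: E7_coef_def)
      then have "\<forall>i\<in>{1..7}. c i = 0" using c(1) d(1) by force
      then have "x = 0" using c(2) by simp
      then show False using x root_norm unfolding positive_roots_def by fastforce
    qed
  qed
qed

end

theory Submission
  imports Defs
begin

text \<open>
  For an involution \<open>\<omega>\<close> the average of \<open>\<beta>\<close> is \<open>(\<omega> \<beta> + \<beta>) / 2\<close>, so the claim concerns the roots in the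
  \<open>-1\<close>-eigenspace of \<open>\<omega> = w\<^sub>7 w\<^sub>0\<close>. This space has dimension three and contains three mutually orthogonal
  roots. A root in the eigenspace has integral coordinates with respect to them, because these
  coordinates are integral combinations of its coefficients at the simple roots, and all roots have
  the same length. Hence the squares of its three coordinates add up to \<open>1\<close>, and the root is one of
  the three up to sign (\<open>omega7_negated_roots\<close>).

  The work is to determine \<open>\<omega>\<close> from the definition of \<open>w\<^sub>0\<close> and \<open>w\<^sub>7\<close> by maximal length. By
  \<open>longest_element_eqI\<close>, which rests on the exchange condition, an element of the Weyl group
  that makes every simple root negative is the unique longest one. As every reflection in a root is a
  product of simple reflections (\<open>reflection_group_roots\<close>), such an element may be given as a product
  of reflections in arbitrary roots. Short products exist: \<open>w\<^sub>0\<close> is \<open>-1\<close> on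
  the span of the roots, hence the product of the reflections in seven orthogonal roots, and \<open>w\<^sub>7\<close>,
  taken in the subsystem of type \<open>E\<^sub>6\<close>, is such a product for four orthogonal roots.

  The set \<open>P(0)\<close> also involves the orbit of \<open>\<alpha>\<^sub>0\<close>, hence the highest root. Its coefficients are the
  integral parts of the bounds that the Cauchy-Schwarz inequality, applied to a root and the
  fundamental weights, gives for the coefficients of all roots (\<open>coefficient_bound\<close>). The orbit is \<open>{0, 7}\<close>, so \<open>P(0)\<close> consists of
  the \<open>\<alpha> 7\<close>-coefficients of the three roots and of their negatives.
\<close>

section \<open>Reflections and words in reflections\<close>

lemma linear_reflection: "linear (reflection a)"
  unfolding reflection_def
  by (intro linearI) (simp_all add: inner_add_left algebra_simps add_divide_distrib)

lemma inner_reflection: "reflection a x \<bullet> reflection a y = x \<bullet> y"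
  unfolding reflection_def
  by (cases "a = 0") (simp_all add: inner_diff_left inner_diff_right inner_commute field_simps)

lemma reflection_involutive [simp]: "reflection a (reflection a x) = x"
  unfolding reflection_def
  by (cases "a = 0") (simp_all add: inner_diff_left inner_diff_right inner_commute field_simps)

lemma reflection_uminus_left: "reflection (- a) = reflection a"
  unfolding reflection_def by simp

lemma reflection_self: "reflection a a = - a"
  unfolding reflection_def by (cases "a = 0") (simp_all add: scaleR_2)

lemma reflection_conj:
  assumes "linear w" "\<And>x y. w x \<bullet> w y = x \<bullet> y"
  shows "reflection (w a) (w x) = w (reflection a x)"
  unfolding reflection_def assms(2) by (simp add: assms(1) linear_diff linear_scale)

lemma reflection_word_Nil [simp]: "reflection_word [] = id"
  by (simp add: reflection_word_def)

lemma reflection_word_Cons: "reflection_word (a # as) = reflection a \<circ> reflection_word as"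
  by (simp add: reflection_word_def)

lemma reflection_word_append:
  "reflection_word (as @ bs) = reflection_word as \<circ> reflection_word bs"
  by (induction as) (auto simp: reflection_word_Cons)

lemma linear_reflection_word: "linear (reflection_word as)"
proof (induction as)
  case Nil
  show ?case unfolding reflection_word_Nil by (rule linear_id)
next
  case (Cons a as)
  then show ?case unfolding reflection_word_Cons by (rule linear_compose) (rule linear_reflection)
qed

lemma inner_reflection_word: "reflection_word as x \<bullet> reflection_word as y = x \<bullet> y"
  by (induction as) (auto simp: reflection_word_Cons inner_reflection)

lemma reflection_word_rev: "reflection_word (rev as) \<circ> reflection_word as = id"
  by (induction as) (auto simp: reflection_word_Cons reflection_word_append fun_eq_iff)

lemma reflection_word_conj:
  "reflection (reflection_word as a) \<circ> reflection_word as = reflection_word as \<circ> reflection a"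
  by (simp add: fun_eq_iff reflection_conj linear_reflection_word inner_reflection_word)

lemma reflection_word_orthogonal:
  "\<forall>a\<in>set as. x \<bullet> a = 0 \<Longrightarrow> reflection_word as x = x"
  by (induction as) (auto simp: reflection_word_Cons reflection_def)

lemma reflection_group_word: "set as \<subseteq> S \<Longrightarrow> reflection_word as \<in> reflection_group S"
  unfolding reflection_group_def by blast

lemma reflection_group_comp:
  assumes "v \<in> reflection_group S" "w \<in> reflection_group S"
  shows "v \<circ> w \<in> reflection_group S"
proof -
  obtain as bs where "set as \<subseteq> S" "v = reflection_word as" "set bs \<subseteq> S" "w = reflection_word bs"
    using assms unfolding reflection_group_def by blast
  then have "v \<circ> w = reflection_word (as @ bs)" "set (as @ bs) \<subseteq> S"
    by (simp_all add: reflection_word_append)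
  then show ?thesis by (metis reflection_group_word)
qed

lemma reflection_group_id: "id \<in> reflection_group S"
  using reflection_group_word[of "[]" S] by simp

lemma linear_reflection_group: "w \<in> reflection_group S \<Longrightarrow> linear w"
  unfolding reflection_group_def using linear_reflection_word by blast

lemma refl_length_word_le: "set as \<subseteq> S \<Longrightarrow> refl_length S (reflection_word as) \<le> length as"
  unfolding refl_length_def by (rule Least_le) blast

lemma obtain_reduced_word:
  assumes "w \<in> reflection_group S"
  obtains as where "set as \<subseteq> S" "length as = refl_length S w" "reflection_word as = w"
proof -
  have "\<exists>n as. set as \<subseteq> S \<and> length as = n \<and> reflection_word as = w"
    using assms unfolding reflection_group_def by blast
  then have "\<exists>as. set as \<subseteq> S \<and> length as = refl_length S w \<and> reflection_word as = w"
    unfolding refl_length_def by (rule LeastI_ex)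
  then show ?thesis using that by blast
qed

text \<open>Reflections in \<open>S\<close> act trivially on the orthogonal complement of \<open>S\<close>, and the ambient space
  is the sum of \<open>span S\<close> and this complement.\<close>

lemma reflection_group_eqI:
  fixes S :: "'a::euclidean_space set"
  assumes v: "v \<in> reflection_group S" and w: "w \<in> reflection_group S"
    and B: "S \<subseteq> span B" and eq: "\<And>b. b \<in> B \<Longrightarrow> v b = w b"
  shows "v = w"
proof
  fix x
  obtain y z where y: "y \<in> span S" and z: "\<And>u. u \<in> span S \<Longrightarrow> orthogonal z u" and x: "x = y + z"
    using orthogonal_subspace_decomp_exists by blast
  have fixed: "u z = z" if u: "u \<in> reflection_group S" for u
  proof -
    obtain as where as: "set as \<subseteq> S" "u = reflection_word as"
      using u unfolding reflection_group_def by blast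
    have "\<forall>a\<in>set as. z \<bullet> a = 0" using z as(1) span_base unfolding orthogonal_def by blast
    then show ?thesis using as(2) reflection_word_orthogonal by blast
  qed
  have "y \<in> span B" using y B by (meson span_minimal subspace_span subsetD)
  then have "v y = w y"
    using linear_eq_on_span[OF linear_reflection_group[OF v] linear_reflection_group[OF w]] eq by blast
  then show "v x = w x"
    using x fixed[OF v] fixed[OF w] linear_reflection_group[OF v] linear_reflection_group[OF w]
    by (simp add: linear_add)
qed

section \<open>Root systems with a base\<close>

definition pos_cone :: "'a::euclidean_space set \<Rightarrow> 'a set" where
  "pos_cone \<Delta> = {x \<in> span \<Delta>. \<forall>a\<in>\<Delta>. 0 \<le> representation \<Delta> x a}"

locale based_root_system =
  fixes \<Phi> \<Delta> :: "'a::euclidean_space set"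
  assumes finite_roots: "finite \<Phi>" and zero_not_root: "0 \<notin> \<Phi>"
    and reflection_root: "a \<in> \<Phi> \<Longrightarrow> b \<in> \<Phi> \<Longrightarrow> reflection a b \<in> \<Phi>"
    and reduced: "a \<in> \<Phi> \<Longrightarrow> c *\<^sub>R a \<in> \<Phi> \<Longrightarrow> c = 1 \<or> c = -1"
    and base_roots: "\<Delta> \<subseteq> \<Phi>" and base_independent: "independent \<Delta>"
    and root_sign: "b \<in> \<Phi> \<Longrightarrow> b \<in> pos_cone \<Delta> \<or> - b \<in> pos_cone \<Delta>"
begin

lemma finite_base: "finite \<Delta>"
  using base_roots finite_roots finite_subset by blast

lemma root_in_span: "b \<in> \<Phi> \<Longrightarrow> b \<in> span \<Delta>"
  using root_sign span_neg[of "- b" \<Delta>] unfolding pos_cone_def by auto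

lemma base_in_pos_cone: "a \<in> \<Delta> \<Longrightarrow> a \<in> pos_cone \<Delta>"
  unfolding pos_cone_def
  by (auto simp: span_base representation_basis base_independent)

lemma pos_cone_comb:
  assumes "\<And>a. a \<in> A \<Longrightarrow> 0 \<le> c a" "\<And>a. a \<in> A \<Longrightarrow> f a \<in> pos_cone \<Delta>"
  shows "(\<Sum>a\<in>A. c a *\<^sub>R f a) \<in> pos_cone \<Delta>"
proof -
  have sp: "\<And>a. a \<in> A \<Longrightarrow> c a *\<^sub>R f a \<in> span \<Delta>" using assms(2) unfolding pos_cone_def by (auto intro: span_scale)
  have "0 \<le> representation \<Delta> (\<Sum>a\<in>A. c a *\<^sub>R f a) d" if d: "d \<in> \<Delta>" for d
  proof -
    have "representation \<Delta> (\<Sum>a\<in>A. c a *\<^sub>R f a) d = (\<Sum>a\<in>A. c a * representation \<Delta> (f a) d)"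
      using assms(2) by (subst representation_sum[OF base_independent sp])
        (auto simp: representation_scale base_independent pos_cone_def intro!: sum.cong)
    also have "0 \<le> \<dots>" using assms d by (intro sum_nonneg) (auto simp: pos_cone_def)
    finally show ?thesis .
  qed
  then show ?thesis using sp unfolding pos_cone_def by (simp add: span_sum)
qed

lemma base_expansion: "x \<in> span \<Delta> \<Longrightarrow> (\<Sum>a\<in>\<Delta>. representation \<Delta> x a *\<^sub>R a) = x"
  using sum_representation_eq[OF base_independent _ finite_base order_refl] .

lemma pos_cone_antisym:
  assumes "x \<in> pos_cone \<Delta>" "- x \<in> pos_cone \<Delta>"
  shows "x = 0"
proof -
  have x: "x \<in> span \<Delta>" using assms(1) unfolding pos_cone_def by blast
  have "representation \<Delta> x a = 0" if "a \<in> \<Delta>" for a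
    using assms that x by (fastforce simp: pos_cone_def representation_neg base_independent)
  then show ?thesis using base_expansion[OF x] by simp
qed

lemma pos_root_not_neg: "b \<in> \<Phi> \<Longrightarrow> b \<in> pos_cone \<Delta> \<Longrightarrow> - b \<notin> pos_cone \<Delta>"
  using pos_cone_antisym zero_not_root by blast

text \<open>A simple reflection changes only one coefficient of a positive root, so the only positive root
  that it can make negative is a multiple of the simple root itself.\<close>

lemma simple_reflection_pos:
  assumes a: "a \<in> \<Delta>" and b: "b \<in> \<Phi>" "b \<in> pos_cone \<Delta>" and ne: "b \<noteq> a"
  shows "reflection a b \<in> pos_cone \<Delta>"
proof (rule ccontr)
  assume no: "reflection a b \<notin> pos_cone \<Delta>"
  have a\<Phi>: "a \<in> \<Phi>" using a base_roots by blast
  have neg: "- reflection a b \<in> pos_cone \<Delta>"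
    using root_sign[OF reflection_root[OF a\<Phi> b(1)]] no by blast
  have sp: "a \<in> span \<Delta>" "b \<in> span \<Delta>" using a\<Phi> b(1) root_in_span by auto
  have "representation \<Delta> b d = 0" if d: "d \<in> \<Delta>" "d \<noteq> a" for d
  proof -
    have "reflection a b \<in> span \<Delta>" using reflection_root[OF a\<Phi> b(1)] root_in_span by blast
    then have "representation \<Delta> (- reflection a b) d = - representation \<Delta> (reflection a b) d"
      by (simp add: representation_neg base_independent)
    also have "representation \<Delta> (reflection a b) d = representation \<Delta> b d"
      using sp d a unfolding reflection_def
      by (simp add: representation_diff representation_scale representation_basis base_independent span_scale)
    finally show ?thesis using neg b(2) d unfolding pos_cone_def by force
  qed
  then have "(\<Sum>d\<in>\<Delta>. representation \<Delta> b d *\<^sub>R d) = (\<Sum>d\<in>\<Delta>. if d = a then representation \<Delta> b a *\<^sub>R a else 0)"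
    by (intro sum.cong) auto
  then have eq: "b = representation \<Delta> b a *\<^sub>R a"
    using base_expansion[OF sp(2)] a finite_base by simp
  then have "representation \<Delta> b a = 1 \<or> representation \<Delta> b a = -1" using reduced[OF a\<Phi>] b(1) by metis
  moreover have "0 \<le> representation \<Delta> b a" using b(2) a unfolding pos_cone_def by blast
  ultimately show False using eq ne by auto
qed

lemma reflection_word_root:
  "set as \<subseteq> \<Phi> \<Longrightarrow> b \<in> \<Phi> \<Longrightarrow> reflection_word as b \<in> \<Phi>"
  by (induction as) (auto simp: reflection_word_Cons reflection_root)

text \<open>The exchange condition. Following the root \<open>a\<close> through the word from the right, there is a first
  letter \<open>b\<close> that makes it negative. At that moment the root is \<open>b\<close> itself, so the part \<open>w\<close> of the
  word to the right of this letter satisfies \<open>w a = b\<close>, and the letter cancels against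
  \<open>w \<circ> reflection a = reflection b \<circ> w\<close>.\<close>

lemma exchange:
  assumes "set as \<subseteq> \<Delta>" "a \<in> \<Delta>" "- reflection_word as a \<in> pos_cone \<Delta>"
  shows "\<exists>bs. set bs \<subseteq> \<Delta> \<and> length bs < length as \<and>
           reflection_word as \<circ> reflection a = reflection_word bs"
  using assms
proof (induction as)
  case Nil
  then show ?case using base_in_pos_cone[of a] pos_root_not_neg base_roots by auto
next
  case (Cons b as)
  have root: "reflection_word as a \<in> \<Phi>"
    using Cons.prems base_roots by (intro reflection_word_root) auto
  show ?case
  proof (cases "- reflection_word as a \<in> pos_cone \<Delta>")
    case True
    have "set as \<subseteq> \<Delta>" using Cons.prems(1) by simp
    from Cons.IH[OF this Cons.prems(2) True]
    obtain bs where "set bs \<subseteq> \<Delta>" "length bs < length as"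
        "reflection_word as \<circ> reflection a = reflection_word bs"
      by blast
    moreover from this have "reflection_word (b # as) \<circ> reflection a = reflection_word (b # bs)"
      by (simp only: reflection_word_Cons comp_assoc)
    ultimately show ?thesis using Cons.prems(1) by (intro exI[of _ "b # bs"]) auto
  next
    case False
    then have pos: "reflection_word as a \<in> pos_cone \<Delta>" using root_sign[OF root] by blast
    have bD: "b \<in> \<Delta>" using Cons.prems(1) by simp
    have "reflection b (reflection_word as a) \<in> \<Phi>"
      using reflection_root root bD base_roots by blast
    then have "reflection b (reflection_word as a) \<notin> pos_cone \<Delta>"
      using Cons.prems(3) pos_root_not_neg by (auto simp: reflection_word_Cons)
    then have "reflection_word as a = b"
      using simple_reflection_pos[OF bD root pos] by blast
    then have "reflection_word (b # as) \<circ> reflection a = reflection_word as"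
      using reflection_word_conj[of as a]
      by (simp add: reflection_word_Cons comp_assoc fun_eq_iff)
    then show ?thesis using Cons.prems(1) by (intro exI[of _ as]) auto
  qed
qed

text \<open>Among the positive roots in the orbit of a root, one of least height is simple: a positive root
  has a positive inner product with some simple root, and reflecting in that simple root lowers the
  height.\<close>

lemma pos_root_conjugate_simple:
  assumes b: "b \<in> \<Phi>" "b \<in> pos_cone \<Delta>"
  shows "\<exists>as a. set as \<subseteq> \<Delta> \<and> a \<in> \<Delta> \<and> b = reflection_word as a"
proof -
  define ht where "ht x = (\<Sum>a\<in>\<Delta>. representation \<Delta> x a)" for x
  define S where "S = {x \<in> \<Phi>. x \<in> pos_cone \<Delta> \<and> (\<exists>as. set as \<subseteq> \<Delta> \<and> b = reflection_word as x)}"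
  have "finite S" unfolding S_def using finite_roots by simp
  moreover have "b \<in> S" unfolding S_def using b by (auto intro!: exI[of _ "[]"])
  ultimately obtain g where g: "g \<in> S" and min: "\<And>x. x \<in> S \<Longrightarrow> ht g \<le> ht x"
    by (metis arg_min_if_finite(1) arg_min_least empty_iff)
  obtain as where as: "set as \<subseteq> \<Delta>" "b = reflection_word as g" using g unfolding S_def by blast
  have gR: "g \<in> \<Phi>" "g \<in> pos_cone \<Delta>" using g unfolding S_def by auto
  have gs: "g \<in> span \<Delta>" using root_in_span gR by blast
  have "0 < g \<bullet> g" using gR zero_not_root by auto
  also have "g \<bullet> g = (\<Sum>a\<in>\<Delta>. representation \<Delta> g a * (a \<bullet> g))"
    by (subst base_expansion[OF gs, symmetric]) (simp add: inner_sum_left)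
  finally obtain a where a: "a \<in> \<Delta>" "0 < representation \<Delta> g a * (a \<bullet> g)"
    by (meson not_le sum_nonpos)
  have pos: "0 < a \<bullet> g" using a gR(2) unfolding pos_cone_def by (auto simp: zero_less_mult_iff)
  have "g = a"
  proof (rule ccontr)
    assume "g \<noteq> a"
    have a\<Phi>: "a \<in> \<Phi>" using a base_roots by blast
    have "reflection a g \<in> S"
      unfolding S_def using simple_reflection_pos[OF a(1) gR \<open>g \<noteq> a\<close>] reflection_root[OF a\<Phi> gR(1)] as a
      by (auto intro!: exI[of _ "as @ [a]"] simp: reflection_word_append reflection_word_Cons)
    then have "ht g \<le> ht (reflection a g)" by (rule min)
    also have "ht (reflection a g) = (\<Sum>d\<in>\<Delta>. representation \<Delta> g d -
        2 * (g \<bullet> a) / (a \<bullet> a) * (if d = a then 1 else 0))"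
      unfolding ht_def reflection_def using a gs
      by (simp add: representation_diff representation_scale representation_basis base_independent
          span_scale span_base)
    also have "\<dots> = ht g - 2 * (g \<bullet> a) / (a \<bullet> a)"
      unfolding sum_subtractf ht_def sum_distrib_left[symmetric] using a finite_base by simp
    finally have "2 * (g \<bullet> a) / (a \<bullet> a) \<le> 0" by simp
    moreover have "0 < a \<bullet> a" using a\<Phi> zero_not_root by auto
    ultimately show False using pos by (simp add: inner_commute divide_le_0_iff)
  qed
  then show ?thesis using as a by blast
qed

lemma root_conjugate_simple:
  assumes "b \<in> \<Phi>"
  shows "\<exists>as a. set as \<subseteq> \<Delta> \<and> a \<in> \<Delta> \<and> (b = reflection_word as a \<or> b = - reflection_word as a)"
proof (cases "b \<in> pos_cone \<Delta>")
  case True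
  then show ?thesis using assms pos_root_conjugate_simple by blast
next
  case False
  then have neg: "- b \<in> pos_cone \<Delta>" using root_sign assms by blast
  have "- b \<in> \<Phi>" using reflection_root[OF assms assms] by (simp add: reflection_self)
  then have "\<exists>as a. set as \<subseteq> \<Delta> \<and> a \<in> \<Delta> \<and> - b = reflection_word as a"
    using neg by (rule pos_root_conjugate_simple)
  then show ?thesis by (metis add.inverse_inverse)
qed

lemma reflection_root_mem:
  assumes "b \<in> \<Phi>"
  shows "reflection b \<in> reflection_group \<Delta>"
proof -
  obtain as a where as: "set as \<subseteq> \<Delta>" "a \<in> \<Delta>" "b = reflection_word as a \<or> b = - reflection_word as a"
    using root_conjugate_simple[OF assms] by blast
  have "reflection b = reflection (reflection_word as a)"
    using as(3) reflection_uminus_left by auto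
  also have "\<dots> = reflection_word as \<circ> reflection a \<circ> reflection_word (rev as)"
    using reflection_word_conj[of as a] reflection_word_rev[of "rev as"]
    by (simp add: fun_eq_iff) metis
  also have "\<dots> = reflection_word (as @ [a] @ rev as)"
    by (simp add: reflection_word_append reflection_word_Cons comp_assoc)
  finally show ?thesis using as(1,2) by (simp add: reflection_group_word)
qed

lemma reflection_group_roots: "reflection_group \<Phi> = reflection_group \<Delta>"
proof
  show "reflection_group \<Delta> \<subseteq> reflection_group \<Phi>"
    unfolding reflection_group_def using base_roots by blast
  have "set as \<subseteq> \<Phi> \<Longrightarrow> reflection_word as \<in> reflection_group \<Delta>" for as
    by (induction as)
      (auto simp: reflection_word_Cons reflection_group_id intro: reflection_group_comp reflection_root_mem)
  then show "reflection_group \<Phi> \<subseteq> reflection_group \<Delta>"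
    unfolding reflection_group_def by blast
qed

section \<open>The longest element\<close>

text \<open>Multiplying \<open>w\<close> from the right by the letters of a reduced word for \<open>v\<inverse>\<close> shortens it at each
  letter \<open>a\<close>. Reducedness makes the prefix send \<open>a\<close> to a positive root, which \<open>w\<close> makes negative;
  the exchange condition then applies.\<close>

lemma length_quotient:
  assumes w: "w \<in> reflection_group \<Delta>" and neg: "\<And>a. a \<in> \<Delta> \<Longrightarrow> - w a \<in> pos_cone \<Delta>"
    and as: "set as \<subseteq> \<Delta>" "length as = refl_length \<Delta> (reflection_word as)"
  shows "refl_length \<Delta> (w \<circ> reflection_word (rev as)) + length as \<le> refl_length \<Delta> w"
  using as
proof (induction as)
  case (Cons a as)
  have sub: "set as \<subseteq> \<Delta>" and a: "a \<in> \<Delta>" using Cons.prems(1) by auto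
  have red: "length as = refl_length \<Delta> (reflection_word as)"
  proof (rule ccontr)
    assume "length as \<noteq> refl_length \<Delta> (reflection_word as)"
    then have less: "refl_length \<Delta> (reflection_word as) < length as"
      using refl_length_word_le[OF sub] by simp
    obtain bs where bs: "set bs \<subseteq> \<Delta>" "length bs = refl_length \<Delta> (reflection_word as)"
        "reflection_word bs = reflection_word as"
      using obtain_reduced_word[OF reflection_group_word[OF sub]] by blast
    have "refl_length \<Delta> (reflection_word (a # bs)) \<le> length (a # bs)"
      using bs a by (intro refl_length_word_le) auto
    moreover have "reflection_word (a # bs) = reflection_word (a # as)"
      by (simp only: reflection_word_Cons bs(3))
    ultimately show False using less bs(2) Cons.prems(2) by simp
  qed
  define u where "u = reflection_word (rev as)"
  have uR: "u a \<in> \<Phi>"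
    unfolding u_def using sub a base_roots by (intro reflection_word_root) auto
  have "- u a \<notin> pos_cone \<Delta>"
  proof
    assume "- u a \<in> pos_cone \<Delta>"
    then obtain bs where bs: "set bs \<subseteq> \<Delta>" "length bs < length as"
        "u \<circ> reflection a = reflection_word bs"
      using exchange[of "rev as" a] sub a unfolding u_def by auto
    have "reflection_word (rev (a # as)) = reflection_word bs"
      using bs(3) by (simp add: u_def reflection_word_append reflection_word_Cons)
    then have "reflection_word (a # as) = reflection_word (rev bs)"
      using reflection_word_rev[of "rev (a # as)"] reflection_word_rev[of bs]
        reflection_word_rev[of "rev bs"] unfolding rev_rev_ident
      by (metis comp_assoc comp_id id_comp)
    then have "refl_length \<Delta> (reflection_word (a # as)) \<le> length (rev bs)"
      using refl_length_word_le[of "rev bs" \<Delta>] bs by simp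
    then show False using Cons.prems(2) bs(2) by simp
  qed
  then have u_pos: "u a \<in> pos_cone \<Delta>" using root_sign[OF uR] by blast
  have wlin: "linear w" using linear_reflection_group[OF w] .
  have "- w (u a) = (\<Sum>d\<in>\<Delta>. representation \<Delta> (u a) d *\<^sub>R (- w d))"
    by (subst base_expansion[OF root_in_span[OF uR], symmetric])
      (simp add: linear_sum[OF wlin] linear_scale[OF wlin] sum_negf)
  also have "\<dots> \<in> pos_cone \<Delta>"
    using u_pos neg by (intro pos_cone_comb) (auto simp: pos_cone_def)
  finally have wu: "- (w \<circ> u) a \<in> pos_cone \<Delta>" by simp
  have "u \<in> reflection_group \<Delta>" unfolding u_def using sub by (intro reflection_group_word) simp
  then have "w \<circ> u \<in> reflection_group \<Delta>" using w reflection_group_comp by blast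
  then obtain cs where cs: "set cs \<subseteq> \<Delta>" "length cs = refl_length \<Delta> (w \<circ> u)"
      "reflection_word cs = w \<circ> u"
    using obtain_reduced_word by blast
  obtain ds where ds: "set ds \<subseteq> \<Delta>" "length ds < length cs"
      "w \<circ> u \<circ> reflection a = reflection_word ds"
    using exchange[OF cs(1) a] wu cs(3) by auto
  have "w \<circ> reflection_word (rev (a # as)) = reflection_word ds"
    using ds(3) by (simp add: u_def reflection_word_append reflection_word_Cons comp_assoc)
  then have "refl_length \<Delta> (w \<circ> reflection_word (rev (a # as))) < refl_length \<Delta> (w \<circ> u)"
    using refl_length_word_le[OF ds(1)] ds(2) cs(2) by simp
  then show ?case using Cons.IH[OF sub red] unfolding u_def list.size by linarith
qed simp

text \<open>Hence \<open>w\<close> has maximal length, and a second element \<open>v\<close> of maximal length has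
  \<open>w \<circ> v\<inverse>\<close> of length \<open>0\<close>.\<close>

theorem longest_element_eqI:
  assumes w: "w \<in> reflection_group \<Delta>" and neg: "\<And>a. a \<in> \<Delta> \<Longrightarrow> - w a \<in> pos_cone \<Delta>"
  shows "longest_element \<Delta> (reflection_group \<Delta>) = w"
  unfolding longest_element_def
proof (rule the_equality)
  have "refl_length \<Delta> v \<le> refl_length \<Delta> w" if v: "v \<in> reflection_group \<Delta>" for v
  proof -
    obtain as where "set as \<subseteq> \<Delta>" "length as = refl_length \<Delta> v" "reflection_word as = v"
      using obtain_reduced_word[OF v] by blast
    then show ?thesis using length_quotient[OF w neg, of as] by simp
  qed
  then show "w \<in> reflection_group \<Delta> \<and> (\<forall>v\<in>reflection_group \<Delta>. refl_length \<Delta> v \<le> refl_length \<Delta> w)"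
    using w by blast
next
  fix v assume v: "v \<in> reflection_group \<Delta> \<and> (\<forall>u\<in>reflection_group \<Delta>. refl_length \<Delta> u \<le> refl_length \<Delta> v)"
  obtain as where as: "set as \<subseteq> \<Delta>" "length as = refl_length \<Delta> v" "reflection_word as = v"
    using obtain_reduced_word v by blast
  have "refl_length \<Delta> w \<le> refl_length \<Delta> v" using v w by blast
  then have zero: "refl_length \<Delta> (w \<circ> reflection_word (rev as)) = 0"
    using length_quotient[OF w neg, of as] as by simp
  have "w \<circ> reflection_word (rev as) \<in> reflection_group \<Delta>"
    using w as(1) by (intro reflection_group_comp reflection_group_word) auto
  then obtain bs where "length bs = 0" "reflection_word bs = w \<circ> reflection_word (rev as)"
    using obtain_reduced_word zero by metis
  then have "w \<circ> reflection_word (rev as) = id" by simp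
  then show "v = w"
    using reflection_word_rev[of as] as(3) by (metis comp_assoc comp_id id_comp)
qed

end

section \<open>Coordinates with respect to the base of type \<open>E\<^sub>7\<close>\<close>

lemma representation_family:
  assumes "finite I" "inj_on \<alpha> I" "independent (\<alpha> ` I)" "j \<in> I"
  shows "representation (\<alpha> ` I) (\<Sum>i\<in>I. c i *\<^sub>R \<alpha> i) (\<alpha> j) = c j"
proof -
  have sp: "\<And>i. i \<in> I \<Longrightarrow> c i *\<^sub>R \<alpha> i \<in> span (\<alpha> ` I)" by (auto intro: span_scale span_base)
  have "representation (\<alpha> ` I) (\<Sum>i\<in>I. c i *\<^sub>R \<alpha> i) (\<alpha> j) =
      (\<Sum>i\<in>I. c i * (if \<alpha> j = \<alpha> i then 1 else 0))"
    using assms(3) by (subst representation_sum[OF assms(3) sp])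
      (auto simp: representation_scale representation_basis span_base intro!: sum.cong)
  also have "\<dots> = (\<Sum>i\<in>I. if i = j then c i else 0)"
    using assms(2,4) by (intro sum.cong) (auto dest: inj_onD)
  also have "\<dots> = c j" using assms(1,4) by simp
  finally show ?thesis .
qed

lemma pos_cone_family:
  assumes "finite I" "inj_on \<alpha> I" "independent (\<alpha> ` I)" "\<And>i. i \<in> I \<Longrightarrow> 0 \<le> c i"
  shows "(\<Sum>i\<in>I. c i *\<^sub>R \<alpha> i) \<in> pos_cone (\<alpha> ` I)"
proof -
  have "(\<Sum>i\<in>I. c i *\<^sub>R \<alpha> i) \<in> span (\<alpha> ` I)"
    by (intro span_sum span_scale span_base) auto
  then show ?thesis using representation_family[OF assms(1-3)] assms(4) unfolding pos_cone_def by auto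
qed

text \<open>The bilinear form given by the Cartan matrix.\<close>

definition cartan_form ::
    "real \<Rightarrow> real \<Rightarrow> real \<Rightarrow> real \<Rightarrow> real \<Rightarrow> real \<Rightarrow> real \<Rightarrow>
     real \<Rightarrow> real \<Rightarrow> real \<Rightarrow> real \<Rightarrow> real \<Rightarrow> real \<Rightarrow> real \<Rightarrow> real" where
  "cartan_form a1 a2 a3 a4 a5 a6 a7 b1 b2 b3 b4 b5 b6 b7 =
     2 * (a1 * b1 + a2 * b2 + a3 * b3 + a4 * b4 + a5 * b5 + a6 * b6 + a7 * b7)
      - (a1 * b3 + a3 * b1) - (a3 * b4 + a4 * b3) - (a2 * b4 + a4 * b2) - (a4 * b5 + a5 * b4)
      - (a5 * b6 + a6 * b5) - (a6 * b7 + a7 * b6)"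

locale E7 =
  fixes \<Phi> :: "'a::euclidean_space set" and \<alpha> :: "nat \<Rightarrow> 'a"
  assumes E7: "E7_root_system \<Phi> \<alpha>"
begin

text \<open>Seven separate coefficients instead of a family turn reflections of explicit vectors into
  arithmetic on numerals, which simplification can carry out.\<close>

definition lin :: "real \<Rightarrow> real \<Rightarrow> real \<Rightarrow> real \<Rightarrow> real \<Rightarrow> real \<Rightarrow> real \<Rightarrow> 'a" where
  "lin a1 a2 a3 a4 a5 a6 a7 = a1 *\<^sub>R \<alpha> 1 + a2 *\<^sub>R \<alpha> 2 + a3 *\<^sub>R \<alpha> 3 + a4 *\<^sub>R \<alpha> 4 +
     a5 *\<^sub>R \<alpha> 5 + a6 *\<^sub>R \<alpha> 6 + a7 *\<^sub>R \<alpha> 7"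

lemma root_system: "root_system \<Phi>" and root_base: "root_base7 \<Phi> \<alpha>"
  using E7 unfolding E7_root_system_def by auto

lemma sum_eq_lin: "(\<Sum>i=1..7. c i *\<^sub>R \<alpha> i) = lin (c 1) (c 2) (c 3) (c 4) (c 5) (c 6) (c 7)"
  unfolding sum_1_7 lin_def ..

lemma simple_eq_lin:
  "\<alpha> 1 = lin 1 0 0 0 0 0 0" "\<alpha> 2 = lin 0 1 0 0 0 0 0" "\<alpha> 3 = lin 0 0 1 0 0 0 0"
  "\<alpha> 4 = lin 0 0 0 1 0 0 0" "\<alpha> 5 = lin 0 0 0 0 1 0 0" "\<alpha> 6 = lin 0 0 0 0 0 1 0"
  "\<alpha> 7 = lin 0 0 0 0 0 0 1"
  by (simp_all add: lin_def)

lemma lin_add: "lin a1 a2 a3 a4 a5 a6 a7 + lin b1 b2 b3 b4 b5 b6 b7 =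
    lin (a1 + b1) (a2 + b2) (a3 + b3) (a4 + b4) (a5 + b5) (a6 + b6) (a7 + b7)"
  by (simp add: lin_def algebra_simps)

lemma lin_diff: "lin a1 a2 a3 a4 a5 a6 a7 - lin b1 b2 b3 b4 b5 b6 b7 =
    lin (a1 - b1) (a2 - b2) (a3 - b3) (a4 - b4) (a5 - b5) (a6 - b6) (a7 - b7)"
  by (simp add: lin_def algebra_simps)

lemma lin_scale: "t *\<^sub>R lin a1 a2 a3 a4 a5 a6 a7 =
    lin (t * a1) (t * a2) (t * a3) (t * a4) (t * a5) (t * a6) (t * a7)"
  by (simp add: lin_def scaleR_add_right)

lemma lin_uminus: "- lin a1 a2 a3 a4 a5 a6 a7 = lin (- a1) (- a2) (- a3) (- a4) (- a5) (- a6) (- a7)"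
  by (simp add: lin_def)

lemma linear_lin:
  assumes "linear f"
  shows "f (lin a1 a2 a3 a4 a5 a6 a7) = a1 *\<^sub>R f (\<alpha> 1) + a2 *\<^sub>R f (\<alpha> 2) + a3 *\<^sub>R f (\<alpha> 3) +
     a4 *\<^sub>R f (\<alpha> 4) + a5 *\<^sub>R f (\<alpha> 5) + a6 *\<^sub>R f (\<alpha> 6) + a7 *\<^sub>R f (\<alpha> 7)"
  unfolding lin_def by (simp add: linear_add[OF assms] linear_scale[OF assms])

lemma lin_eq_iff [simp]:
  "lin a1 a2 a3 a4 a5 a6 a7 = lin b1 b2 b3 b4 b5 b6 b7 \<longleftrightarrow>
     a1 = b1 \<and> a2 = b2 \<and> a3 = b3 \<and> a4 = b4 \<and> a5 = b5 \<and> a6 = b6 \<and> a7 = b7"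
proof
  define c where "c i = [0, a1, a2, a3, a4, a5, a6, a7] ! i" for i
  define d where "d i = [0, b1, b2, b3, b4, b5, b6, b7] ! i" for i
  assume "lin a1 a2 a3 a4 a5 a6 a7 = lin b1 b2 b3 b4 b5 b6 b7"
  then have eq: "(\<Sum>i=1..7. c i *\<^sub>R \<alpha> i) = (\<Sum>i=1..7. d i *\<^sub>R \<alpha> i)"
    unfolding sum_eq_lin by (simp add: c_def d_def)
  have fam: "inj_on \<alpha> {1..7}" "independent (\<alpha> ` {1..7})"
    using root_base unfolding root_base7_def by auto
  have "c i = d i" if i: "i \<in> {1..7}" for i
    using representation_family[OF finite_atLeastAtMost fam i, of c]
      representation_family[OF finite_atLeastAtMost fam i, of d] unfolding eq by (rule trans[OF sym])
  then have "\<forall>i\<in>{1..7}. c i = d i" by blast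
  then show "a1 = b1 \<and> a2 = b2 \<and> a3 = b3 \<and> a4 = b4 \<and> a5 = b5 \<and> a6 = b6 \<and> a7 = b7"
    unfolding ball_1_7 by (simp add: c_def d_def)
qed simp

lemma nonneg_comb_lin:
  "nonneg_comb \<alpha> (lin a1 a2 a3 a4 a5 a6 a7) \<longleftrightarrow>
     0 \<le> a1 \<and> 0 \<le> a2 \<and> 0 \<le> a3 \<and> 0 \<le> a4 \<and> 0 \<le> a5 \<and> 0 \<le> a6 \<and> 0 \<le> a7"
proof
  assume "nonneg_comb \<alpha> (lin a1 a2 a3 a4 a5 a6 a7)"
  then show "0 \<le> a1 \<and> 0 \<le> a2 \<and> 0 \<le> a3 \<and> 0 \<le> a4 \<and> 0 \<le> a5 \<and> 0 \<le> a6 \<and> 0 \<le> a7"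
    unfolding nonneg_comb_def sum_eq_lin ball_1_7 by auto
next
  assume "0 \<le> a1 \<and> 0 \<le> a2 \<and> 0 \<le> a3 \<and> 0 \<le> a4 \<and> 0 \<le> a5 \<and> 0 \<le> a6 \<and> 0 \<le> a7"
  then show "nonneg_comb \<alpha> (lin a1 a2 a3 a4 a5 a6 a7)"
    unfolding nonneg_comb_def sum_eq_lin ball_1_7
    by (intro exI[of _ "\<lambda>i. [0, a1, a2, a3, a4, a5, a6, a7] ! i"]) simp
qed

lemma root_eq_lin:
  assumes "b \<in> \<Phi>"
  obtains c1 c2 c3 c4 c5 c6 c7 :: int where "b = lin c1 c2 c3 c4 c5 c6 c7"
proof -
  obtain c :: "nat \<Rightarrow> int" where "b = (\<Sum>i=1..7. of_int (c i) *\<^sub>R \<alpha> i)"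
    using assms root_base unfolding root_base7_def by blast
  then show ?thesis using that unfolding sum_eq_lin by blast
qed

sublocale based_root_system \<Phi> "\<alpha> ` {1..7}"
proof
  show "b \<in> pos_cone (\<alpha> ` {1..7}) \<or> - b \<in> pos_cone (\<alpha> ` {1..7})" if b: "b \<in> \<Phi>" for b
  proof -
    have fam: "inj_on \<alpha> {1..7}" "independent (\<alpha> ` {1..7})" using root_base unfolding root_base7_def by auto
    obtain c :: "nat \<Rightarrow> int" where c: "b = (\<Sum>i=1..7. of_int (c i) *\<^sub>R \<alpha> i)"
        "(\<forall>i\<in>{1..7}. 0 \<le> c i) \<or> (\<forall>i\<in>{1..7}. c i \<le> 0)"
      using b root_base unfolding root_base7_def by blast
    have "- b = (\<Sum>i=1..7. of_int (- c i) *\<^sub>R \<alpha> i)" unfolding c(1) by (simp add: sum_negf)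
    then show ?thesis
      using c pos_cone_family[OF _ fam, of "\<lambda>i. of_int (c i)"]
        pos_cone_family[OF _ fam, of "\<lambda>i. of_int (- c i)"] by auto
  qed
qed (use root_system root_base in \<open>auto simp: root_system_def root_base7_def\<close>)

text \<open>The roots in the span of \<open>\<alpha> 1, \<dots>, \<alpha> 6\<close> form a system of type \<open>E\<^sub>6\<close>. A root in this span has
  no \<open>\<alpha> 7\<close>-component, so its coefficients keep their common sign.\<close>

sublocale E6: based_root_system "\<Phi> \<inter> span (\<alpha> ` {1..6})" "\<alpha> ` {1..6}"
proof
  let ?V = "span (\<alpha> ` {1..6})"
  have fam7: "inj_on \<alpha> {1..7}" "independent (\<alpha> ` {1..7})" using root_base unfolding root_base7_def by auto
  have "{1..6} \<subseteq> {1..7::nat}" by auto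
  then have fam: "inj_on \<alpha> {1..6}" "independent (\<alpha> ` {1..6})"
    using fam7 independent_mono[OF fam7(2) image_mono] by (blast intro: inj_on_subset)+
  have "\<alpha> i \<noteq> \<alpha> 7" if "i \<in> {1..6}" for i
    using inj_onD[OF fam7(1), of i 7] that by auto
  then have "\<alpha> ` {1..6} \<subseteq> \<alpha> ` {1..7} - {\<alpha> 7}" by auto
  moreover have "\<alpha> 7 \<notin> span (\<alpha> ` {1..7} - {\<alpha> 7})"
    using fam7(2) unfolding dependent_def by auto
  ultimately have \<alpha>7: "\<alpha> 7 \<notin> ?V" using span_mono by blast
  show "independent (\<alpha> ` {1..6})" by (rule fam)
  show "reflection a b \<in> \<Phi> \<inter> ?V" if "a \<in> \<Phi> \<inter> ?V" "b \<in> \<Phi> \<inter> ?V" for a b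
  proof -
    have "reflection a b \<in> ?V" unfolding reflection_def using that by (auto intro: span_diff span_scale)
    then show ?thesis using that reflection_root by blast
  qed
  show "b \<in> pos_cone (\<alpha> ` {1..6}) \<or> - b \<in> pos_cone (\<alpha> ` {1..6})" if b: "b \<in> \<Phi> \<inter> ?V" for b
  proof -
    obtain c :: "nat \<Rightarrow> int" where c: "b = (\<Sum>i=1..7. of_int (c i) *\<^sub>R \<alpha> i)"
        "(\<forall>i\<in>{1..7}. 0 \<le> c i) \<or> (\<forall>i\<in>{1..7}. c i \<le> 0)"
      using b root_base unfolding root_base7_def by blast
    have split: "b = (\<Sum>i=1..6. of_int (c i) *\<^sub>R \<alpha> i) + of_int (c 7) *\<^sub>R \<alpha> 7"
      unfolding c(1) sum_1_7 sum_1_6 ..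
    have "(\<Sum>i=1..6. of_int (c i) *\<^sub>R \<alpha> i) \<in> ?V" by (intro span_sum span_scale span_base) auto
    then have mem: "of_int (c 7) *\<^sub>R \<alpha> 7 \<in> ?V" using b span_diff[of b _ "(\<Sum>i=1..6. of_int (c i) *\<^sub>R \<alpha> i)"] split by auto
    have "c 7 = 0"
    proof (rule ccontr)
      assume "c 7 \<noteq> 0"
      then have "\<alpha> 7 = inverse (of_int (c 7)) *\<^sub>R of_int (c 7) *\<^sub>R \<alpha> 7" by simp
      then show False using \<alpha>7 span_scale[OF mem] by metis
    qed
    then have b6: "b = (\<Sum>i=1..6. of_int (c i) *\<^sub>R \<alpha> i)" using split by simp
    then have "- b = (\<Sum>i=1..6. of_int (- c i) *\<^sub>R \<alpha> i)" by (simp add: sum_negf)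
    then show ?thesis
      using c(2) b6 pos_cone_family[OF _ fam, of "\<lambda>i. of_int (c i)"]
        pos_cone_family[OF _ fam, of "\<lambda>i. of_int (- c i)"] by auto
  qed
qed (use finite_roots zero_not_root reduced base_roots in \<open>auto intro: span_base\<close>)

lemma simple_root: "i \<in> {1..7} \<Longrightarrow> \<alpha> i \<in> \<Phi>"
  using base_roots by blast

definition sqlen :: real where "sqlen = \<alpha> 1 \<bullet> \<alpha> 1"

lemma sqlen_pos: "0 < sqlen"
  using simple_root[of 1] zero_not_root unfolding sqlen_def by auto

text \<open>Every edge of the diagram joins two simple roots of equal length, and the diagram is
  connected.\<close>

lemma inner_simple:
  assumes "i \<in> {1..7}" "j \<in> {1..7}"
  shows "\<alpha> i \<bullet> \<alpha> j = sqlen / 2 * E7_cartan i j"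
proof -
  have eq: "2 * (\<alpha> i \<bullet> \<alpha> j) = E7_cartan i j * (\<alpha> j \<bullet> \<alpha> j)" if "i \<in> {1..7}" "j \<in> {1..7}" for i j
  proof -
    have "\<alpha> j \<in> \<Phi>" using that(2) base_roots by blast
    then have "\<alpha> j \<bullet> \<alpha> j \<noteq> 0" using zero_not_root by auto
    then show ?thesis using E7 that unfolding E7_root_system_def by (metis nonzero_eq_divide_eq)
  qed
  have edge: "\<alpha> i \<bullet> \<alpha> i = \<alpha> j \<bullet> \<alpha> j" if "i \<in> {1..7}" "j \<in> {1..7}" "{i, j} \<in> E7_edges" "i \<noteq> j" for i j
    using eq[OF that(1,2)] eq[OF that(2,1)] that(3,4)
    by (simp add: E7_cartan_def insert_commute inner_commute)
  have all: "\<forall>j\<in>{1..7}. \<alpha> j \<bullet> \<alpha> j = sqlen"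
    using edge[of 1 3] edge[of 3 4] edge[of 2 4] edge[of 4 5] edge[of 5 6] edge[of 6 7]
    unfolding ball_1_7 sqlen_def by (simp add: E7_edges_def)
  show ?thesis using eq[OF assms] bspec[OF all assms(2)] by (simp add: field_simps)
qed

lemma inner_lin:
  "lin a1 a2 a3 a4 a5 a6 a7 \<bullet> lin b1 b2 b3 b4 b5 b6 b7 = 
     sqlen / 2 * cartan_form a1 a2 a3 a4 a5 a6 a7 b1 b2 b3 b4 b5 b6 b7"
  unfolding lin_def cartan_form_def
  by (simp add: inner_add_left inner_add_right inner_simple E7_cartan_def E7_edges_def doubleton_eq_iff)
     (simp add: field_simps)

lemma reflection_lin:
  assumes "cartan_form b1 b2 b3 b4 b5 b6 b7 b1 b2 b3 b4 b5 b6 b7 = 2"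
  shows "reflection (lin b1 b2 b3 b4 b5 b6 b7) (lin a1 a2 a3 a4 a5 a6 a7) =
   (let t = cartan_form a1 a2 a3 a4 a5 a6 a7 b1 b2 b3 b4 b5 b6 b7
    in lin (a1 - t * b1) (a2 - t * b2) (a3 - t * b3) (a4 - t * b4) (a5 - t * b5) (a6 - t * b6) (a7 - t * b7))"
  unfolding reflection_def inner_lin assms Let_def lin_scale lin_diff using sqlen_pos by simp

text \<open>Every root is up to sign the image of a simple root under a word in reflections, which is an isometry.\<close>

lemma root_norm:
  assumes "b \<in> \<Phi>"
  shows "b \<bullet> b = sqlen"
proof -
  obtain as a where "a \<in> \<alpha> ` {1..7}" "b = reflection_word as a \<or> b = - reflection_word as a"
    using root_conjugate_simple[OF assms] by blast
  then have "b \<bullet> b = a \<bullet> a" by (auto simp: inner_reflection_word)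
  also have "\<dots> = sqlen" using \<open>a \<in> _\<close> by (auto simp: inner_simple E7_cartan_def)
  finally show ?thesis .
qed

lemma uminus_root: "b \<in> \<Phi> \<Longrightarrow> - b \<in> \<Phi>"
  using reflection_root[of b b] by (simp add: reflection_self)

lemma add_root:
  assumes "a \<in> \<Phi>" "b \<in> \<Phi>" "a \<bullet> b = - sqlen / 2"
  shows "a + b \<in> \<Phi>"
proof -
  have "reflection b a = a + b"
    unfolding reflection_def root_norm[OF assms(2)] assms(3) using sqlen_pos by simp
  then show ?thesis using reflection_root[OF assms(2,1)] by simp
qed

lemma lin_add_root:
  assumes "lin a1 a2 a3 a4 a5 a6 a7 \<in> \<Phi>" "lin b1 b2 b3 b4 b5 b6 b7 \<in> \<Phi>"
    and "cartan_form a1 a2 a3 a4 a5 a6 a7 b1 b2 b3 b4 b5 b6 b7 = -1"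
  shows "lin (a1 + b1) (a2 + b2) (a3 + b3) (a4 + b4) (a5 + b5) (a6 + b6) (a7 + b7) \<in> \<Phi>"
  using add_root[OF assms(1,2)] unfolding inner_lin assms(3) lin_add by simp

text \<open>Two roots of equal length whose Cartan integer is \<open>-1\<close> add up to a root, so each of these
  vectors arises from simple roots through a chain of such sums.\<close>

lemma some_roots:
  shows "lin 0 0 1 1 1 0 0 \<in> \<Phi>" and "lin 1 0 1 1 1 1 0 \<in> \<Phi>"
    and "lin 0 1 1 2 1 0 0 \<in> \<Phi>" and root_0112221: "lin 0 1 1 2 2 2 1 \<in> \<Phi>"
    and root_1122111: "lin 1 1 2 2 1 1 1 \<in> \<Phi>" and root_1112211: "lin 1 1 1 2 2 1 1 \<in> \<Phi>"
    and "lin 1 2 2 3 2 1 0 \<in> \<Phi>" and root_2234321: "lin 2 2 3 4 3 2 1 \<in> \<Phi>"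
proof -
  have s: "lin 1 0 0 0 0 0 0 \<in> \<Phi>" "lin 0 1 0 0 0 0 0 \<in> \<Phi>" "lin 0 0 1 0 0 0 0 \<in> \<Phi>"
    "lin 0 0 0 1 0 0 0 \<in> \<Phi>" "lin 0 0 0 0 1 0 0 \<in> \<Phi>" "lin 0 0 0 0 0 1 0 \<in> \<Phi>" "lin 0 0 0 0 0 0 1 \<in> \<Phi>"
    unfolding simple_eq_lin[symmetric] by (simp_all add: simple_root)
  have 34: "lin 0 0 1 1 0 0 0 \<in> \<Phi>" using lin_add_root[OF s(3) s(4)] by (simp add: cartan_form_def)
  show 345: "lin 0 0 1 1 1 0 0 \<in> \<Phi>" using lin_add_root[OF 34 s(5)] by (simp add: cartan_form_def)
  have "lin 1 0 1 1 1 0 0 \<in> \<Phi>" using lin_add_root[OF 345 s(1)] by (simp add: cartan_form_def)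
  from lin_add_root[OF this s(6)] show a5: "lin 1 0 1 1 1 1 0 \<in> \<Phi>" by (simp add: cartan_form_def)
  have "lin 0 1 1 1 1 0 0 \<in> \<Phi>" using lin_add_root[OF 345 s(2)] by (simp add: cartan_form_def)
  from lin_add_root[OF this s(4)] show d4: "lin 0 1 1 2 1 0 0 \<in> \<Phi>" by (simp add: cartan_form_def)
  from lin_add_root[OF this s(6)] have d46: "lin 0 1 1 2 1 1 0 \<in> \<Phi>" by (simp add: cartan_form_def)
  from lin_add_root[OF this s(5)] have "lin 0 1 1 2 2 1 0 \<in> \<Phi>" by (simp add: cartan_form_def)
  from lin_add_root[OF this s(7)] have "lin 0 1 1 2 2 1 1 \<in> \<Phi>" by (simp add: cartan_form_def)
  from lin_add_root[OF this s(6)] show "lin 0 1 1 2 2 2 1 \<in> \<Phi>" by (simp add: cartan_form_def)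
  have "lin 0 1 1 2 1 1 1 \<in> \<Phi>" using lin_add_root[OF d46 s(7)] by (simp add: cartan_form_def)
  from lin_add_root[OF this s(1)] have b: "lin 1 1 1 2 1 1 1 \<in> \<Phi>" by (simp add: cartan_form_def)
  from lin_add_root[OF this s(3)] show "lin 1 1 2 2 1 1 1 \<in> \<Phi>" by (simp add: cartan_form_def)
  from lin_add_root[OF b s(5)] show "lin 1 1 1 2 2 1 1 \<in> \<Phi>" by (simp add: cartan_form_def)
  have "lin 1 1 1 2 1 0 0 \<in> \<Phi>" using lin_add_root[OF d4 s(1)] by (simp add: cartan_form_def)
  from lin_add_root[OF this s(3)] have "lin 1 1 2 2 1 0 0 \<in> \<Phi>" by (simp add: cartan_form_def)
  from lin_add_root[OF this s(6)] have "lin 1 1 2 2 1 1 0 \<in> \<Phi>" by (simp add: cartan_form_def)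
  from lin_add_root[OF this s(5)] have "lin 1 1 2 2 2 1 0 \<in> \<Phi>" by (simp add: cartan_form_def)
  from lin_add_root[OF this s(4)] have "lin 1 1 2 3 2 1 0 \<in> \<Phi>" by (simp add: cartan_form_def)
  from lin_add_root[OF this s(2)] show e6: "lin 1 2 2 3 2 1 0 \<in> \<Phi>" by (simp add: cartan_form_def)
  have "lin 1 0 1 1 1 1 1 \<in> \<Phi>" using lin_add_root[OF a5 s(7)] by (simp add: cartan_form_def)
  from lin_add_root[OF e6 this] show "lin 2 2 3 4 3 2 1 \<in> \<Phi>" by (simp add: cartan_form_def)
qed

section \<open>The elements \<open>w\<^sub>0\<close>, \<open>w\<^sub>7\<close> and \<open>\<omega>\<close> in coordinates\<close>

text \<open>The seven roots come from repeatedly passing to the highest root of a component of the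
  subsystem orthogonal to the roots already chosen (\<open>E\<^sub>7 \<supset> D\<^sub>6 \<supset> A\<^sub>1 \<times> D\<^sub>4 \<supset> \<dots>\<close>). Being orthogonal
  and as many as the rank, they have \<open>-1\<close> as the product of their reflections.\<close>

lemma w_0_lin: "w_0 \<Phi> \<alpha> (lin a1 a2 a3 a4 a5 a6 a7) = lin (- a1) (- a2) (- a3) (- a4) (- a5) (- a6) (- a7)"
  and w_0_mem: "w_0 \<Phi> \<alpha> \<in> reflection_group \<Phi>"
proof -
  define as where "as = [lin 2 2 3 4 3 2 1, lin 0 1 1 2 2 2 1, lin 0 0 0 0 0 0 1, lin 0 1 1 2 1 0 0,
    lin 0 1 0 0 0 0 0, lin 0 0 1 0 0 0 0, lin 0 0 0 0 1 0 0]"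
  define w where "w = reflection_word as"
  have "set as \<subseteq> \<Phi>"
    using some_roots simple_root[of 2] simple_root[of 3] simple_root[of 5] simple_root[of 7]
    unfolding as_def simple_eq_lin by simp
  then have mem: "w \<in> reflection_group \<Phi>" unfolding w_def by (rule reflection_group_word)
  have act: "w (\<alpha> 1) = - \<alpha> 1" "w (\<alpha> 2) = - \<alpha> 2" "w (\<alpha> 3) = - \<alpha> 3" "w (\<alpha> 4) = - \<alpha> 4"
    "w (\<alpha> 5) = - \<alpha> 5" "w (\<alpha> 6) = - \<alpha> 6" "w (\<alpha> 7) = - \<alpha> 7"
    unfolding simple_eq_lin lin_uminus w_def as_def
    by (simp_all add: reflection_word_Cons reflection_lin cartan_form_def)
  have "\<forall>i\<in>{1..7}. w (\<alpha> i) = - \<alpha> i" unfolding ball_1_7 using act by blast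
  then have "- w a \<in> pos_cone (\<alpha> ` {1..7})" if "a \<in> \<alpha> ` {1..7}" for a
    using that base_in_pos_cone by force
  then have w0: "w_0 \<Phi> \<alpha> = w"
    unfolding w_0_def reflection_group_roots
    using mem longest_element_eqI unfolding reflection_group_roots by blast
  show "w_0 \<Phi> \<alpha> \<in> reflection_group \<Phi>" unfolding w0 by (rule mem)
  show "w_0 \<Phi> \<alpha> (lin a1 a2 a3 a4 a5 a6 a7) = lin (- a1) (- a2) (- a3) (- a4) (- a5) (- a6) (- a7)"
    unfolding w0 linear_lin[OF linear_reflection_group[OF mem]] act by (simp add: lin_def)
qed

text \<open>The same construction inside \<open>E\<^sub>6\<close> (\<open>E\<^sub>6 \<supset> A\<^sub>5 \<supset> A\<^sub>3 \<supset> A\<^sub>1\<close>) stops after four roots. The product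
  of their reflections is \<open>-1\<close> on their span and the identity on its complement, and it exchanges
  \<open>\<alpha> 1\<close> with \<open>- \<alpha> 6\<close> and \<open>\<alpha> 3\<close> with \<open>- \<alpha> 5\<close>.\<close>

lemma w_7_lin: "w_7 \<alpha> (lin a1 a2 a3 a4 a5 a6 a7) =
    lin (2 * a7 - a6) (2 * a7 - a2) (3 * a7 - a5) (4 * a7 - a4) (3 * a7 - a3) (2 * a7 - a1) a7"
  and w_7_mem: "w_7 \<alpha> \<in> reflection_group \<Phi>"
proof -
  let ?V = "span (\<alpha> ` {1..6})"
  define as where "as = [lin 1 2 2 3 2 1 0, lin 1 0 1 1 1 1 0, lin 0 0 1 1 1 0 0, lin 0 0 0 1 0 0 0]"
  define w where "w = reflection_word as"
  have V: "lin b1 b2 b3 b4 b5 b6 0 \<in> ?V" for b1 b2 b3 b4 b5 b6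
  proof -
    have "b1 *\<^sub>R \<alpha> 1 + b2 *\<^sub>R \<alpha> 2 + b3 *\<^sub>R \<alpha> 3 + b4 *\<^sub>R \<alpha> 4 + b5 *\<^sub>R \<alpha> 5 + b6 *\<^sub>R \<alpha> 6 \<in> ?V"
      by (intro span_add span_scale span_base) auto
    then show ?thesis by (simp add: lin_def)
  qed
  have as: "set as \<subseteq> \<Phi> \<inter> ?V"
    using some_roots simple_root[of 4] V unfolding as_def simple_eq_lin by simp
  have mem: "w \<in> reflection_group \<Phi>" unfolding w_def using as by (intro reflection_group_word) auto
  have mem6: "w \<in> reflection_group (\<alpha> ` {1..6})"
    unfolding w_def E6.reflection_group_roots[symmetric] using as by (rule reflection_group_word)
  have act: "w (\<alpha> 1) = - \<alpha> 6" "w (\<alpha> 2) = - \<alpha> 2" "w (\<alpha> 3) = - \<alpha> 5" "w (\<alpha> 4) = - \<alpha> 4"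
    "w (\<alpha> 5) = - \<alpha> 3" "w (\<alpha> 6) = - \<alpha> 1" "w (\<alpha> 7) = lin 2 2 3 4 3 2 1"
    unfolding simple_eq_lin lin_uminus w_def as_def
    by (simp_all add: reflection_word_Cons reflection_lin cartan_form_def)
  have "\<forall>i\<in>{1..6}. - w (\<alpha> i) \<in> \<alpha> ` {1..6}" unfolding ball_1_6 act by simp
  then have "- w a \<in> pos_cone (\<alpha> ` {1..6})" if "a \<in> \<alpha> ` {1..6}" for a
    using that E6.base_in_pos_cone by blast
  then have w7: "w_7 \<alpha> = w"
    unfolding w_7_def using mem6 E6.longest_element_eqI by blast
  show "w_7 \<alpha> \<in> reflection_group \<Phi>" unfolding w7 by (rule mem)
  show "w_7 \<alpha> (lin a1 a2 a3 a4 a5 a6 a7) =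
      lin (2 * a7 - a6) (2 * a7 - a2) (3 * a7 - a5) (4 * a7 - a4) (3 * a7 - a3) (2 * a7 - a1) a7"
    unfolding w7 linear_lin[OF linear_reflection_group[OF mem]] act
    by (simp add: lin_def algebra_simps)
qed

lemma omega7_lin: "omega7 \<Phi> \<alpha> (lin a1 a2 a3 a4 a5 a6 a7) =
    lin (a6 - 2 * a7) (a2 - 2 * a7) (a5 - 3 * a7) (a4 - 4 * a7) (a3 - 3 * a7) (a1 - 2 * a7) (- a7)"
  unfolding omega7_def by (simp add: w_0_lin w_7_lin)

text \<open>On the roots this is read off the coordinates; orthogonally to them every product of reflections
  is the identity, so the equation holds on the whole ambient space, as the order of \<open>\<omega>\<close> requires.\<close>

lemma omega7_involution: "omega7 \<Phi> \<alpha> \<circ> omega7 \<Phi> \<alpha> = id"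
proof (rule reflection_group_eqI)
  have "omega7 \<Phi> \<alpha> \<in> reflection_group \<Phi>"
    unfolding omega7_def using w_0_mem w_7_mem by (rule reflection_group_comp[rotated])
  then show "omega7 \<Phi> \<alpha> \<circ> omega7 \<Phi> \<alpha> \<in> reflection_group \<Phi>" by (blast intro: reflection_group_comp)
  show "id \<in> reflection_group \<Phi>" by (rule reflection_group_id)
  show "\<Phi> \<subseteq> span \<Phi>" by (auto intro: span_base)
  fix b assume "b \<in> \<Phi>"
  then obtain c1 c2 c3 c4 c5 c6 c7 :: int where "b = lin c1 c2 c3 c4 c5 c6 c7" by (rule root_eq_lin)
  then show "(omega7 \<Phi> \<alpha> \<circ> omega7 \<Phi> \<alpha>) b = id b" by (simp add: omega7_lin)
qed

lemma average_omega7: "average (omega7 \<Phi> \<alpha>) x = (1/2) *\<^sub>R (omega7 \<Phi> \<alpha> x + x)"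
proof -
  have sq: "omega7 \<Phi> \<alpha> ^^ 2 = id"
    using omega7_involution by (simp add: numeral_2_eq_2 del: One_nat_def)
  have "omega7 \<Phi> \<alpha> (\<alpha> 7) \<noteq> \<alpha> 7" unfolding simple_eq_lin omega7_lin by simp
  then have ne: "omega7 \<Phi> \<alpha> ^^ 1 \<noteq> id" by auto
  have "2 \<le> t" if "0 < t \<and> omega7 \<Phi> \<alpha> ^^ t = id" for t :: nat
  proof (rule ccontr)
    assume "\<not> 2 \<le> t"
    then have "t = 1" using that by linarith
    then show False using that ne by blast
  qed
  then have "map_order (omega7 \<Phi> \<alpha>) = 2"
    unfolding map_order_def using sq by (intro Least_equality) auto
  moreover have "{1..2::nat} = {1, 2}" by auto
  ultimately show ?thesis unfolding average_def using sq by simp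
qed

section \<open>Roots negated by \<open>\<omega>\<close>\<close>

text \<open>The \<open>-1\<close>-eigenspace of \<open>\<omega>\<close> is spanned by the three mutually orthogonal roots below. If a root
  lies in it, its coordinates \<open>x\<close>, \<open>y\<close>, \<open>z\<close> with respect to them are integral combinations of its
  simple-root coefficients, and equality of lengths says \<open>x\<^sup>2 + y\<^sup>2 + z\<^sup>2 = 1\<close>.\<close>

lemma omega7_negated_roots:
  "{b \<in> \<Phi>. omega7 \<Phi> \<alpha> b = - b} =
     {lin 0 1 1 2 2 2 1, lin 1 1 2 2 1 1 1, lin 1 1 1 2 2 1 1,
      - lin 0 1 1 2 2 2 1, - lin 1 1 2 2 1 1 1, - lin 1 1 1 2 2 1 1}" (is "?L = ?R")
proof
  have "omega7 \<Phi> \<alpha> b = - b \<and> omega7 \<Phi> \<alpha> (- b) = - (- b)"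
    if "b \<in> {lin 0 1 1 2 2 2 1, lin 1 1 2 2 1 1 1, lin 1 1 1 2 2 1 1}" for b
    using that by (elim insertE emptyE) (simp_all add: lin_uminus omega7_lin)
  then show "?R \<subseteq> ?L"
    using root_0112221 root_1122111 root_1112211 by (simp add: uminus_root)
  show "?L \<subseteq> ?R"
  proof
    fix b assume "b \<in> ?L"
    then have b: "b \<in> \<Phi>" "omega7 \<Phi> \<alpha> b = - b" by auto
    obtain c1 c2 c3 c4 c5 c6 c7 :: int where c: "b = lin c1 c2 c3 c4 c5 c6 c7"
      using root_eq_lin[OF b(1)] by metis
    \<comment> \<open>the coordinates of \<open>b\<close> with respect to the three roots\<close>
    define x y z where "x = c7 - c1" and "y = c3 - c7" and "z = c1 + c7 - c3"
    have "real_of_int c1 = y + z" "real_of_int c2 = x + y + z" "real_of_int c3 = x + 2 * y + z"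
      "real_of_int c4 = 2 * x + 2 * y + 2 * z" "real_of_int c5 = 2 * x + y + 2 * z"
      "real_of_int c6 = 2 * x + y + z" "real_of_int c7 = x + y + z"
      using b(2) unfolding c omega7_lin lin_uminus lin_eq_iff x_def y_def z_def by auto
    then have eq: "b = lin (y + z) (x + y + z) (x + 2 * y + z) (2 * x + 2 * y + 2 * z) (2 * x + y + 2 * z)
        (2 * x + y + z) (x + y + z)"
      unfolding c by simp
    have "sqlen = sqlen * of_int (x * x + y * y + z * z)"
      using root_norm[OF b(1)] unfolding eq inner_lin cartan_form_def by (simp add: algebra_simps)
    then have "real_of_int (x * x + y * y + z * z) = 1" using sqlen_pos by simp
    then have sq: "x * x + y * y + z * z = 1" by linarith
    have le: "\<bar>t\<bar> \<le> 1" if "t * t \<le> 1" for t :: int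
      using that abs_le_square_iff[of t 1] by (simp add: power2_eq_square)
    have "x * x \<le> 1" "y * y \<le> 1" "z * z \<le> 1"
      using sq zero_le_square[of x] zero_le_square[of y] zero_le_square[of z] by linarith+
    then have "x \<in> {-1, 0, 1}" "y \<in> {-1, 0, 1}" "z \<in> {-1, 0, 1}"
      using le[of x] le[of y] le[of z] by auto
    then show "b \<in> ?R" using sq unfolding eq by (elim insertE emptyE) (simp_all add: lin_uminus)
  qed
qed

lemma zero_average_roots: "{b \<in> \<Phi>. average (omega7 \<Phi> \<alpha>) b = 0} = {b \<in> \<Phi>. omega7 \<Phi> \<alpha> b = - b}"
  unfolding average_omega7 by (auto simp: eq_neg_iff_add_eq_0)

lemma Phi_omega0_pos_eq_lin:
  "Phi_omega0_pos \<Phi> \<alpha> = {lin 0 1 1 2 2 2 1, lin 1 1 2 2 1 1 1, lin 1 1 1 2 2 1 1}"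
proof -
  have "Phi_omega0_pos \<Phi> \<alpha> = {b \<in> {b \<in> \<Phi>. omega7 \<Phi> \<alpha> b = - b}. nonneg_comb \<alpha> b}"
    unfolding zero_average_roots[symmetric] Phi_omega0_pos_def positive_roots_def by blast
  moreover have split: "{b \<in> insert a A. nonneg_comb \<alpha> b} =
      (if nonneg_comb \<alpha> a then {a} else {}) \<union> {b \<in> A. nonneg_comb \<alpha> b}" for a A
    by auto
  ultimately show ?thesis
    unfolding omega7_negated_roots lin_uminus split by (simp add: nonneg_comb_lin insert_commute)
qed

section \<open>The highest root and the set \<open>P(0)\<close>\<close>

text \<open>If \<open>f\<close> is the fundamental weight of index \<open>i\<close>, then \<open>t\<close> is the \<open>i\<close>-th coefficient of \<open>b\<close> and \<open>k\<close>
  the \<open>i\<close>-th coefficient of \<open>f\<close>. Cauchy-Schwarz gives \<open>t\<^sup>2 \<le> 2 k\<close>, and for \<open>E\<^sub>7\<close> the largest integer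
  allowed by this is the coefficient of the highest root.\<close>

lemma coefficient_bound:
  fixes t n :: int
  assumes b: "b \<in> \<Phi>" and f: "b \<bullet> f = sqlen / 2 * of_int t" "f \<bullet> f = sqlen / 2 * k"
    and k: "2 * k < of_int ((n + 1)\<^sup>2)" and n: "0 \<le> n"
  shows "t \<le> n"
proof -
  have "(b \<bullet> f)\<^sup>2 \<le> (b \<bullet> b) * (f \<bullet> f)" by (rule Cauchy_Schwarz_ineq)
  then have "(sqlen / 2)\<^sup>2 * (of_int t)\<^sup>2 \<le> (sqlen / 2)\<^sup>2 * (2 * k)"
    unfolding f root_norm[OF b] by (simp add: power2_eq_square algebra_simps)
  then have "(of_int t)\<^sup>2 \<le> 2 * k" using sqlen_pos by simp
  then have "(of_int t)\<^sup>2 < (of_int (n + 1) :: real)\<^sup>2" using k by simp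
  then have "real_of_int t < of_int (n + 1)" by (rule power2_less_imp_less) (use n in simp)
  then show ?thesis by linarith
qed

lemma highest_root_lin: "highest_root \<Phi> \<alpha> = lin 2 2 3 4 3 2 1"
  unfolding highest_root_def
proof (rule the_equality)
  have dom: "nonneg_comb \<alpha> (lin 2 2 3 4 3 2 1 - b)" if b: "b \<in> \<Phi>" for b
  proof -
    obtain c1 c2 c3 c4 c5 c6 c7 :: int where c: "b = lin c1 c2 c3 c4 c5 c6 c7"
      using root_eq_lin[OF b] by metis
    note bound = coefficient_bound[OF b]
    \<comment> \<open>The vectors below are the fundamental weights, that is, the columns of the inverse Cartan matrix.\<close>
    have "c1 \<le> 2" by (rule bound[of "lin 2 2 3 4 3 2 1" _ 2]) (simp_all add: c inner_lin cartan_form_def)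
    moreover have "c2 \<le> 2"
      by (rule bound[of "lin 2 (7/2) 4 6 (9/2) 3 (3/2)" _ "7/2"]) (simp_all add: c inner_lin cartan_form_def)
    moreover have "c3 \<le> 3"
      by (rule bound[of "lin 3 4 6 8 6 4 2" _ 6]) (simp_all add: c inner_lin cartan_form_def)
    moreover have "c4 \<le> 4"
      by (rule bound[of "lin 4 6 8 12 9 6 3" _ 12]) (simp_all add: c inner_lin cartan_form_def)
    moreover have "c5 \<le> 3"
      by (rule bound[of "lin 3 (9/2) 6 9 (15/2) 5 (5/2)" _ "15/2"]) (simp_all add: c inner_lin cartan_form_def)
    moreover have "c6 \<le> 2"
      by (rule bound[of "lin 2 3 4 6 5 4 2" _ 4]) (simp_all add: c inner_lin cartan_form_def)
    moreover have "c7 \<le> 1"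
      by (rule bound[of "lin 1 (3/2) 2 3 (5/2) 2 (3/2)" _ "3/2"]) (simp_all add: c inner_lin cartan_form_def)
    ultimately show ?thesis unfolding c lin_diff nonneg_comb_lin by simp
  qed
  then show max: "lin 2 2 3 4 3 2 1 \<in> \<Phi> \<and> (\<forall>b\<in>\<Phi>. nonneg_comb \<alpha> (lin 2 2 3 4 3 2 1 - b))"
    using root_2234321 by blast
  fix t assume t: "t \<in> \<Phi> \<and> (\<forall>b\<in>\<Phi>. nonneg_comb \<alpha> (t - b))"
  then obtain c1 c2 c3 c4 c5 c6 c7 :: int where c: "t = lin c1 c2 c3 c4 c5 c6 c7"
    using root_eq_lin by metis
  have "nonneg_comb \<alpha> (t - lin 2 2 3 4 3 2 1)" "nonneg_comb \<alpha> (lin 2 2 3 4 3 2 1 - t)"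
    using t max by blast+
  then show "t = lin 2 2 3 4 3 2 1" unfolding c lin_diff nonneg_comb_lin by simp
qed

text \<open>The powers of \<open>\<omega>\<close> only move \<open>\<alpha>\<^sub>0\<close> between itself and \<open>\<alpha> 7\<close>.\<close>

lemma index_orbit_0: "index_orbit \<Phi> \<alpha> 0 = {0, 7}"
proof -
  let ?\<omega> = "omega7 \<Phi> \<alpha>"
  have \<alpha>0: "extended_simple \<Phi> \<alpha> 0 = lin (-2) (-2) (-3) (-4) (-3) (-2) (-1)"
    by (simp add: extended_simple_def highest_root_lin lin_uminus)
  have \<omega>0: "?\<omega> (extended_simple \<Phi> \<alpha> 0) = \<alpha> 7" unfolding \<alpha>0 omega7_lin simple_eq_lin by simp
  have \<omega>7: "?\<omega> (\<alpha> 7) = extended_simple \<Phi> \<alpha> 0" unfolding \<alpha>0 simple_eq_lin omega7_lin by simp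
  have pow: "(?\<omega> ^^ t) (extended_simple \<Phi> \<alpha> 0) \<in> {extended_simple \<Phi> \<alpha> 0, \<alpha> 7}" for t
    by (induction t) (auto simp: \<omega>0 \<omega>7)
  have ne: "\<forall>i\<in>{1..6}. \<alpha> i \<notin> {extended_simple \<Phi> \<alpha> 0, \<alpha> 7}"
    unfolding ball_1_6 \<alpha>0 simple_eq_lin by simp
  have "i \<in> {0, 7}" if i: "i \<in> {0..7}" "(?\<omega> ^^ t) (extended_simple \<Phi> \<alpha> 0) = extended_simple \<Phi> \<alpha> i" for i t
  proof (rule ccontr)
    assume "i \<notin> {0, 7}"
    then have "i \<in> {1..6}" using i(1) by auto
    moreover have "extended_simple \<Phi> \<alpha> i = \<alpha> i" using \<open>i \<notin> {0, 7}\<close> by (simp add: extended_simple_def)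
    ultimately show False using ne pow[of t] i(2) by metis
  qed
  moreover have "(?\<omega> ^^ 0) (extended_simple \<Phi> \<alpha> 0) = extended_simple \<Phi> \<alpha> 0" by simp
  moreover have "(?\<omega> ^^ 1) (extended_simple \<Phi> \<alpha> 0) = extended_simple \<Phi> \<alpha> 7"
    using \<omega>0 by (simp add: extended_simple_def)
  ultimately show ?thesis unfolding index_orbit_def by fastforce
qed

lemma inner_coweight_7:
  "lin a1 a2 a3 a4 a5 a6 a7 \<bullet> coweight \<Phi> \<alpha> 7 = a7"
proof -
  let ?P = "\<lambda>v. v \<in> span \<Phi> \<and> (\<forall>j\<in>{1..7}. v \<bullet> \<alpha> j = (if j = 7 then 1 else 0))"
  \<comment> \<open>As all simple roots have squared length \<open>sqlen\<close>, a coweight is \<open>2 / sqlen\<close> times the weight.\<close>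
  define v where "v = (2 / sqlen) *\<^sub>R lin 1 (3/2) 2 3 (5/2) 2 (3/2)"
  have vlin: "v \<bullet> lin a1 a2 a3 a4 a5 a6 a7 = a7" for a1 a2 a3 a4 a5 a6 a7
    unfolding v_def inner_scaleR_left inner_lin using sqlen_pos by (simp add: cartan_form_def)
  have sp: "lin a1 a2 a3 a4 a5 a6 a7 \<in> span \<Phi>" for a1 a2 a3 a4 a5 a6 a7
    unfolding lin_def using simple_root by (intro span_add span_scale span_base) auto
  have "v \<in> span \<Phi>" unfolding v_def by (rule span_scale[OF sp])
  then have Pv: "?P v" unfolding ball_1_7 simple_eq_lin vlin by simp
  have "u = v" if u: "?P u" for u
  proof -
    have "orthogonal (u - v) x" if "x \<in> \<alpha> ` {1..7}" for x
      using u Pv that by (auto simp: orthogonal_def inner_diff_left)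
    then have orth: "orthogonal (u - v) x" if "x \<in> span (\<alpha> ` {1..7})" for x
      using orthogonal_to_span[OF that] by blast
    have "u - v \<in> span \<Phi>" using u Pv span_diff[of u \<Phi> v] by blast
    also have "span \<Phi> \<subseteq> span (\<alpha> ` {1..7})"
      using root_in_span by (intro span_minimal) auto
    finally have "orthogonal (u - v) (u - v)" by (rule orth)
    then show ?thesis by (simp add: orthogonal_self)
  qed
  with Pv have "(THE v. ?P v) = v" by (intro the_equality)
  then have "coweight \<Phi> \<alpha> 7 = v" by (simp add: coweight_def)
  then show ?thesis using vlin by (simp add: inner_commute)
qed

text \<open>Each of the three roots contains \<open>\<alpha> 7\<close> exactly once, and \<open>\<varpi>\<^sub>0\<^sup>\<or> = 0\<close>.\<close>

lemma P0_eq: "P0 \<Phi> \<alpha> = {1, -1}"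
proof -
  have "orbit_coweight \<Phi> \<alpha> 0 = coweight \<Phi> \<alpha> 7"
    unfolding orbit_coweight_def index_orbit_0 by (simp add: coweight_def)
  then have "P0 \<Phi> \<alpha> = (\<lambda>b. b \<bullet> coweight \<Phi> \<alpha> 7) ` {b \<in> \<Phi>. omega7 \<Phi> \<alpha> b = - b}"
    unfolding P0_def zero_average_roots[symmetric] by auto
  also have "\<dots> = {1, -1}"
    unfolding omega7_negated_roots by (simp add: inner_coweight_7)
  finally show ?thesis .
qed

end

theorem proposition5p20:
  fixes \<Phi> :: "'a::euclidean_space set" and \<alpha> :: "nat \<Rightarrow> 'a"
  assumes "E7_root_system \<Phi> \<alpha>"
  shows "Phi_omega0_pos \<Phi> \<alpha> =
       {\<alpha> 2 + \<alpha> 3 + 2 *\<^sub>R \<alpha> 4 + 2 *\<^sub>R \<alpha> 5 + 2 *\<^sub>R \<alpha> 6 + \<alpha> 7,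
        \<alpha> 1 + \<alpha> 2 + 2 *\<^sub>R \<alpha> 3 + 2 *\<^sub>R \<alpha> 4 + \<alpha> 5 + \<alpha> 6 + \<alpha> 7,
        \<alpha> 1 + \<alpha> 2 + \<alpha> 3 + 2 *\<^sub>R \<alpha> 4 + 2 *\<^sub>R \<alpha> 5 + \<alpha> 6 + \<alpha> 7}
     \<and> Phi_omega0_pos E7_roots E7_simple =
       {e 6 + e 5,
        (1/2) *\<^sub>R (- e 1 + e 2 + e 3 - e 4 - e 5 + e 6 - e 7 + e 8),
        (1/2) *\<^sub>R (e 1 - e 2 - e 3 + e 4 - e 5 + e 6 - e 7 + e 8)}
     \<and> P0 \<Phi> \<alpha> = {1, -1}"
proof (intro conjI)
  interpret E7 \<Phi> \<alpha> by (rule E7.intro) (rule assms)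
  show "Phi_omega0_pos \<Phi> \<alpha> =
       {\<alpha> 2 + \<alpha> 3 + 2 *\<^sub>R \<alpha> 4 + 2 *\<^sub>R \<alpha> 5 + 2 *\<^sub>R \<alpha> 6 + \<alpha> 7,
        \<alpha> 1 + \<alpha> 2 + 2 *\<^sub>R \<alpha> 3 + 2 *\<^sub>R \<alpha> 4 + \<alpha> 5 + \<alpha> 6 + \<alpha> 7,
        \<alpha> 1 + \<alpha> 2 + \<alpha> 3 + 2 *\<^sub>R \<alpha> 4 + 2 *\<^sub>R \<alpha> 5 + \<alpha> 6 + \<alpha> 7}"
    unfolding Phi_omega0_pos_eq_lin by (simp add: lin_def)
  show "P0 \<Phi> \<alpha> = {1, -1}" by (rule P0_eq)
next
  interpret R8: E7 E7_roots E7_simple by (rule E7.intro) (rule E7_root_system_E7_roots)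
  have "R8.lin 0 1 1 2 2 2 1 = e 6 + e 5"
    "R8.lin 1 1 2 2 1 1 1 = (1/2) *\<^sub>R (- e 1 + e 2 + e 3 - e 4 - e 5 + e 6 - e 7 + e 8)"
    "R8.lin 1 1 1 2 2 1 1 = (1/2) *\<^sub>R (e 1 - e 2 - e 3 + e 4 - e 5 + e 6 - e 7 + e 8)"
    unfolding R8.lin_def vec_eq_iff forall_8 by (simp_all add: E7_simple_def e_nth)
  then show "Phi_omega0_pos E7_roots E7_simple =
       {e 6 + e 5,
        (1/2) *\<^sub>R (- e 1 + e 2 + e 3 - e 4 - e 5 + e 6 - e 7 + e 8),
        (1/2) *\<^sub>R (e 1 - e 2 - e 3 + e 4 - e 5 + e 6 - e 7 + e 8)}"
    using R8.Phi_omega0_pos_eq_lin by simp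
qed

end
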